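(* Let $(G_t;\ t\geq 0)$ be a real-valued centered Gaussian process, assumed to be continuous in probability (which is equivalent to its covariance function $(s,t)\mapsto \mathbb{E}[G_sG_t]$ being continuous). Then the following properties are equivalent: 1. $(G_t;\ t\geq 0)$ is an IDT process. 2. The covariance function $c(s,t):=\mathbb{E}[G_sG_t]$, $0\leq s\leq t$, satisfies: for all $\alpha>0$, $c(\alpha s,\alpha t)=\alpha\, c(s,t)$ for all $0\leq s\leq t$. 3. For all $\alpha>0$, $(G_{\alpha t};\ t\geq 0)\overset{(d)}{=}(\sqrt{\alpha}\,G_t;\ t\geq 0)$. 4. The process $(\tilde{G}_y:=e^{-y/2}G_{e^y};\ y\in\mathbb{R})$ is strictly stationary. 5. The covariance function $\tilde{c}(y,z):=\mathbb{E}[\tilde{G}_y\tilde{G}_z]$, $y,z\in\mathbb{R}$, of the process $\tilde G_y:=e^{-y/2}G_{e^y}$ is of the form $$\tilde{c}(y,z)=\int_{\mathbb{R}} \mu(du)\,e^{iu|y-z|},\qquad y,z\in\mathbb{R},$$ where $\mu$ is a positive, finite, symmetric measure on $\mathbb{R}$. Moreover, under these equivalent conditions, the covariance function of $(G_t;\ t\geq 0)$ is given by $$c(s,t)=\sqrt{st}\int_{\mathbb{R}}\mu(da)\,e^{ia\left|\ln\left(\frac{s}{t}\right)\right|},\qquad s,t>0,$$ where $\mu$ is the measure in property 5.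
   Context: A real-valued stochastic process $(X_t;\ t\geq 0)$ is called an IDT process (infinitely divisible with respect to time) if for every integer $n\geq 1$, $(X_{nt};\ t\geq 0)\overset{(d)}{=}(X^{(1)}_t+\dots+X^{(n)}_t;\ t\geq 0)$, where $X^{(1)},\dots,X^{(n)}$ are independent copies of $X$ and $\overset{(d)}{=}$ denotes equality in law of processes, i.e. equality of all finite-dimensional distributions. *)

theory Defs
  imports "HOL-Probability.Probability"
begin

text \<open>A stochastic process with index set \<open>T\<close> is a function \<open>X\<close> with \<open>X t \<omega>\<close> the value at time \<open>t\<close>;
  values at times outside \<open>T\<close> are irrelevant.\<close>

text \<open>The case \<open>\<sigma> = 0\<close> is the point mass at \<open>m\<close>, as is usual for Gaussian processes;
  \<^const>\<open>normal_density\<close> itself is meaningful only for positive \<open>\<sigma>\<close>.\<close>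

definition gaussian_law :: "real \<Rightarrow> real \<Rightarrow> real measure" where
  "gaussian_law m \<sigma> =
     (if \<sigma> = 0 then return borel m else density lborel (\<lambda>x. ennreal (normal_density m \<sigma> x)))"

definition gaussian_process :: "'a measure \<Rightarrow> 'i set \<Rightarrow> ('i \<Rightarrow> 'a \<Rightarrow> real) \<Rightarrow> bool" where
  "gaussian_process M T X \<longleftrightarrow>
     (\<forall>t\<in>T. X t \<in> borel_measurable M) \<and>
     (\<forall>J a. finite J \<and> J \<subseteq> T \<longrightarrow>
        (\<exists>m \<sigma>. \<sigma> \<ge> 0 \<and> distr M borel (\<lambda>\<omega>. \<Sum>t\<in>J. a t * X t \<omega>) = gaussian_law m \<sigma>))"

definition centered_process :: "'a measure \<Rightarrow> 'i set \<Rightarrow> ('i \<Rightarrow> 'a \<Rightarrow> real) \<Rightarrow> bool" where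
  "centered_process M T X \<longleftrightarrow> (\<forall>t\<in>T. integrable M (X t) \<and> (LINT \<omega>|M. X t \<omega>) = 0)"

text \<open>No centring term: the processes considered are centred.\<close>

definition covariance :: "'a measure \<Rightarrow> ('i \<Rightarrow> 'a \<Rightarrow> real) \<Rightarrow> 'i \<Rightarrow> 'i \<Rightarrow> real" where
  "covariance M X s t = (LINT \<omega>|M. X s \<omega> * X t \<omega>)"

definition continuous_in_probability ::
    "'a measure \<Rightarrow> real set \<Rightarrow> (real \<Rightarrow> 'a \<Rightarrow> real) \<Rightarrow> bool" where
  "continuous_in_probability M T X \<longleftrightarrow>
     (\<forall>t\<in>T. \<forall>\<epsilon>>0. ((\<lambda>s. measure M {\<omega>\<in>space M. \<bar>X s \<omega> - X t \<omega>\<bar> > \<epsilon>}) \<longlongrightarrow> 0) (at t within T))"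

text \<open>Equality of all finite-dimensional distributions; the two processes may live on
  different probability spaces.\<close>

definition eq_in_law ::
    "'i set \<Rightarrow> 'a measure \<Rightarrow> ('i \<Rightarrow> 'a \<Rightarrow> real) \<Rightarrow> 'b measure \<Rightarrow> ('i \<Rightarrow> 'b \<Rightarrow> real) \<Rightarrow> bool" where
  "eq_in_law T M X N Y \<longleftrightarrow>
     (\<forall>J. finite J \<and> J \<subseteq> T \<longrightarrow>
        distr M (\<Pi>\<^sub>M t\<in>J. borel) (\<lambda>\<omega>. \<lambda>t\<in>J. X t \<omega>) =
        distr N (\<Pi>\<^sub>M t\<in>J. borel) (\<lambda>\<omega>. \<lambda>t\<in>J. Y t \<omega>))"

text \<open>The independent copies of \<open>X\<close> are realised on the \<open>n\<close>-fold product of the underlying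
  probability space: the \<open>i\<close>-th copy is \<open>X\<close> evaluated at the \<open>i\<close>-th coordinate. The lemmas
  \<open>copies_indep\<close> and \<open>copies_eq_in_law\<close> below confirm that these are independent copies; the law of their
  sum does not depend on the realisation.\<close>

definition copies_space :: "nat \<Rightarrow> 'a measure \<Rightarrow> (nat \<Rightarrow> 'a) measure" where
  "copies_space n M = (\<Pi>\<^sub>M i\<in>{..<n}. M)"

definition indep_copy :: "('i \<Rightarrow> 'a \<Rightarrow> real) \<Rightarrow> nat \<Rightarrow> 'i \<Rightarrow> (nat \<Rightarrow> 'a) \<Rightarrow> real" where
  "indep_copy X i t \<omega> = X t (\<omega> i)"

lemma copies_indep:
  assumes "prob_space M" and "\<And>t. t \<in> T \<Longrightarrow> X t \<in> borel_measurable M"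
  shows "prob_space.indep_vars (copies_space n M) (\<lambda>_. \<Pi>\<^sub>M t\<in>T. borel)
    (\<lambda>i \<omega>. \<lambda>t\<in>T. indep_copy X i t \<omega>) {..<n}"
proof -
  interpret P: prob_space "copies_space n M"
    unfolding copies_space_def by (intro prob_space_PiM assms)
  have rv: "(\<lambda>\<omega>. \<omega> i) \<in> measurable (copies_space n M) M" if "i \<in> {..<n}" for i
    unfolding copies_space_def using that by (rule measurable_component_singleton)
  have 1: "P.indep_vars (\<lambda>_. M) (\<lambda>i \<omega>. \<omega> i) {..<n}"
  proof (cases "n = 0")
    case True
    then show ?thesis unfolding P.indep_vars_def P.indep_sets_def by auto
  next
    case False
    have "distr (copies_space n M) (\<Pi>\<^sub>M i\<in>{..<n}. M) (\<lambda>\<omega>. \<lambda>i\<in>{..<n}. \<omega> i)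
        = distr (copies_space n M) (copies_space n M) (\<lambda>\<omega>. \<omega>)"
      by (rule distr_cong) (auto simp: copies_space_def space_PiM PiE_restrict)
    also have "\<dots> = (\<Pi>\<^sub>M i\<in>{..<n}. distr (copies_space n M) M (\<lambda>\<omega>. \<omega> i))"
      unfolding distr_id copies_space_def
      by (rule PiM_cong) (auto intro: distr_PiM_component[symmetric] assms(1))
    finally show ?thesis
      using False by (subst P.indep_vars_iff_distr_eq_PiM') (auto intro: rv)
  qed
  have "P.indep_vars (\<lambda>_. \<Pi>\<^sub>M t\<in>T. borel) (\<lambda>i. (\<lambda>x. \<lambda>t\<in>T. X t x) \<circ> (\<lambda>\<omega>. \<omega> i)) {..<n}"
    by (rule P.indep_vars_compose[OF 1]) (intro measurable_restrict assms)
  then show ?thesis by (simp add: indep_copy_def comp_def)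
qed

lemma copies_eq_in_law:
  assumes "prob_space M" and "\<And>t. t \<in> T \<Longrightarrow> X t \<in> borel_measurable M" and "i < n"
  shows "eq_in_law T (copies_space n M) (indep_copy X i) M X"
  unfolding eq_in_law_def
proof (intro allI impI, elim conjE)
  fix J assume J: "finite J" "J \<subseteq> T"
  let ?f = "\<lambda>x. \<lambda>t\<in>J. X t x"
  have m: "?f \<in> measurable M (\<Pi>\<^sub>M t\<in>J. borel)"
    using J assms(2) by (intro measurable_restrict) auto
  have c: "(\<lambda>\<omega>. \<omega> i) \<in> measurable (copies_space n M) M"
    unfolding copies_space_def using assms(3) by (intro measurable_component_singleton) auto
  have "distr M (\<Pi>\<^sub>M t\<in>J. borel) ?f
      = distr (distr (copies_space n M) M (\<lambda>\<omega>. \<omega> i)) (\<Pi>\<^sub>M t\<in>J. borel) ?f"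
    using distr_PiM_component[of "{..<n}" "\<lambda>_. M" i] assms(1,3) by (simp add: copies_space_def)
  also have "\<dots> = distr (copies_space n M) (\<Pi>\<^sub>M t\<in>J. borel) (\<lambda>\<omega>. ?f (\<omega> i))"
    by (subst distr_distr[OF m c]) (simp add: comp_def)
  finally show "distr (copies_space n M) (\<Pi>\<^sub>M t\<in>J. borel) (\<lambda>\<omega>. \<lambda>t\<in>J. indep_copy X i t \<omega>)
      = distr M (\<Pi>\<^sub>M t\<in>J. borel) (\<lambda>\<omega>. \<lambda>t\<in>J. X t \<omega>)"
    by (simp add: indep_copy_def)
qed

definition IDT_process :: "'a measure \<Rightarrow> (real \<Rightarrow> 'a \<Rightarrow> real) \<Rightarrow> bool" where
  "IDT_process M X \<longleftrightarrow>
     (\<forall>n\<ge>1. eq_in_law {0..} M (\<lambda>t. X (real n * t))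
        (copies_space n M) (\<lambda>t \<omega>. \<Sum>i<n. indep_copy X i t \<omega>))"

definition strictly_stationary :: "'a measure \<Rightarrow> (real \<Rightarrow> 'a \<Rightarrow> real) \<Rightarrow> bool" where
  "strictly_stationary M X \<longleftrightarrow> (\<forall>h. eq_in_law UNIV M (\<lambda>y. X (y + h)) M X)"

definition tilde_process :: "(real \<Rightarrow> 'a \<Rightarrow> real) \<Rightarrow> real \<Rightarrow> 'a \<Rightarrow> real" where
  "tilde_process G y \<omega> = exp (- y / 2) * G (exp y) \<omega>"

definition finite_symmetric_measure :: "real measure \<Rightarrow> bool" where
  "finite_symmetric_measure \<mu> \<longleftrightarrow>
     sets \<mu> = sets borel \<and> finite_measure \<mu> \<and> distr \<mu> borel uminus = \<mu>"

definition spectral_measure_of :: "'a measure \<Rightarrow> (real \<Rightarrow> 'a \<Rightarrow> real) \<Rightarrow> real measure \<Rightarrow> bool" where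
  "spectral_measure_of M Y \<mu> \<longleftrightarrow>
     finite_symmetric_measure \<mu> \<and>
     (\<forall>y z. complex_of_real (covariance M Y y z) = (CLINT u|\<mu>. iexp (u * \<bar>y - z\<bar>)))"

end

theory Submission
  imports Defs
begin

text \<open>A centered Gaussian process is determined in law by its covariance, because linear combinations
  have characteristic function \<open>exp (- Q / 2)\<close> with \<open>Q\<close> the covariance form and because the laws of all
  linear combinations determine the joint law (Cramer-Wold). The sum of \<open>n\<close> independent copies has
  covariance \<open>n c\<close>, so being IDT means \<open>c (n s) (n t) = n c s t\<close>; this extends to rational and, by
  continuity, to real factors. Under \<open>s = exp y\<close> the scaling relation becomes stationarity of the
  covariance of the transformed process, and Bochner's theorem provides the spectral measure.

  Bochner's theorem is obtained from Fejer means on the grids \<open>2\<^sup>-\<^sup>m \<int>\<close>: they have nonnegative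
  densities on a period, their characteristic functions converge pointwise to the given function, and
  tightness yields a limit measure.\<close>

section \<open>The Cramer-Wold device\<close>

text \<open>Uniqueness of characteristic functions concerns one real variable, so joint laws are
  compared one coordinate at a time: the exponential in that coordinate is exchanged for an
  indicator while all other factors act as a weight. This is why uniqueness is first extended to
  weighted measures. In Bochner's theorem the Fejer measures have known characteristic functions
  only at integer frequencies up to their order; their support in [-\<pi>, \<pi>] bounds the
  oscillation in between, so the limit exists at every real frequency. No limit law is known
  beforehand, and tightness has to come from continuity of the limit function at 0. Continuity of
  the covariance on the closed quadrant serves twice more after the passage to real factors: it
  makes the covariance of the transformed process continuous, as Bochner's theorem demands, and it
  recovers the times s = 0 or t = 0, which s = exp y never reaches.\<close>

lemma weighted_indicator_eq_of_weighted_char_eq: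
  fixes X f :: "'a \<Rightarrow> real" and Y g :: "'b \<Rightarrow> real"
  assumes "finite_measure M" "finite_measure N"
    and [measurable]: "X \<in> borel_measurable M" "Y \<in> borel_measurable N"
      "f \<in> borel_measurable M" "g \<in> borel_measurable N"
    and f: "\<And>x. 0 \<le> f x" "\<And>x. f x \<le> B" and g: "\<And>y. 0 \<le> g y" "\<And>y. g y \<le> B"
    and eq: "\<And>u. (CLINT x|M. iexp (u * X x) * f x) = (CLINT y|N. iexp (u * Y y) * g y)"
    and [measurable]: "A \<in> sets borel"
  shows "(LINT x|M. indicator A (X x) * f x) = (LINT y|N. indicator A (Y y) * g y)"
proof -
  interpret M: finite_measure M by fact
  interpret N: finite_measure N by fact
  have intf: "integrable M f"
    by (rule M.integrable_const_bound[where B=B]) (use f in auto)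
  have intg: "integrable N g"
    by (rule N.integrable_const_bound[where B=B]) (use g in auto)
  define m where "m = (LINT x|M. f x)"
  \<comment> \<open>Frequency 0 compares the total masses, so both weights can be normalised by the
    same \<open>m\<close>; if \<open>m\<close> is 0, both weights vanish almost everywhere.\<close>
  have "complex_of_real (LINT x|M. f x) = complex_of_real (LINT y|N. g y)"
    using eq[of 0] by simp
  then have m': "m = (LINT y|N. g y)" unfolding m_def of_real_eq_iff .
  show ?thesis
  proof (cases "m = 0")
    case True
    have "AE x in M. f x = 0"
      using True integral_nonneg_eq_0_iff_AE[OF intf] f unfolding m_def by simp
    then have 1: "(LINT x|M. indicator A (X x) * f x) = (LINT x|M. 0)"
      by (intro integral_cong_AE) auto
    have "AE x in N. g x = 0"
      using True integral_nonneg_eq_0_iff_AE[OF intg] g unfolding m' by simp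
    then have 2: "(LINT x|N. indicator A (Y x) * g x) = (LINT x|N. 0)"
      by (intro integral_cong_AE) auto
    show ?thesis using 1 2 by simp
  next
    case False
    have mpos: "m > 0" using False f unfolding m_def
      by (metis Bochner_Integration.integral_nonneg order_le_less)
    \<comment> \<open>The normalised weights are probability densities, and the characteristic
      functions of the resulting laws of \<open>X\<close> and \<open>Y\<close> are the given
      integrals divided by \<open>m\<close>.\<close>
    let ?P = "distr (density M (\<lambda>x. ennreal (f x / m))) borel X"
    let ?Q = "distr (density N (\<lambda>x. ennreal (g x / m))) borel Y"
    have P: "real_distribution ?P"
    proof -
      have "prob_space (density M (\<lambda>x. ennreal (f x / m)))"
        by (rule prob_spaceI, subst emeasure_density)
           (use f mpos intf in \<open>auto simp: nn_integral_eq_integral m_def[symmetric] simp flip: ennreal_indicator cong: nn_integral_cong\<close>)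
      then have "prob_space ?P" by (rule prob_space.prob_space_distr) simp
      then show ?thesis by (simp add: real_distribution_def real_distribution_axioms_def)
    qed
    have Q: "real_distribution ?Q"
    proof -
      have "prob_space (density N (\<lambda>x. ennreal (g x / m)))"
        by (rule prob_spaceI, subst emeasure_density)
           (use g mpos intg in \<open>auto simp: nn_integral_eq_integral m'[symmetric] simp flip: ennreal_indicator cong: nn_integral_cong\<close>)
      then have "prob_space ?Q" by (rule prob_space.prob_space_distr) simp
      then show ?thesis by (simp add: real_distribution_def real_distribution_axioms_def)
    qed
    have chP: "char ?P u = (CLINT x|M. iexp (u * X x) * f x) / m" for u
      unfolding char_def
      by (subst integral_distr, simp, simp, subst integral_density)
         (use f mpos in \<open>auto simp: scaleR_conv_of_real mult.commute simp del: of_real_mult\<close>)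
    have chQ: "char ?Q u = (CLINT x|N. iexp (u * Y x) * g x) / m" for u
      unfolding char_def
      by (subst integral_distr, simp, simp, subst integral_density)
         (use g mpos in \<open>auto simp: scaleR_conv_of_real mult.commute simp del: of_real_mult\<close>)
    have "?P = ?Q"
      by (rule Levy_uniqueness[OF P Q]) (use chP chQ eq in auto)
    then have "(LINT x|?P. indicator A x :: real) = (LINT x|?Q. indicator A x)" by simp
    moreover have "(LINT x|?P. indicator A x :: real) = (LINT x|M. indicator A (X x) * f x) / m"
      by (subst integral_distr, simp, simp, subst integral_density)
         (use f mpos in \<open>auto simp: mult.commute\<close>)
    moreover have "(LINT x|?Q. indicator A x :: real) = (LINT x|N. indicator A (Y x) * g x) / m"
      by (subst integral_distr, simp, simp, subst integral_density)
         (use g mpos in \<open>auto simp: mult.commute\<close>)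
    ultimately show ?thesis using False by simp
  qed
qed

text \<open>Levy's uniqueness theorem needs nonnegative weights; a complex weight dominated by \<open>h\<close>
  is recovered from the nonnegative weights \<open>h\<close>, \<open>h + Re f\<close> and \<open>h + Im f\<close>.\<close>

lemma complex_weighted_indicator_eq_of_weighted_char_eq:
  fixes X h :: "'a \<Rightarrow> real" and Y k :: "'b \<Rightarrow> real" and f :: "'a \<Rightarrow> complex" and g :: "'b \<Rightarrow> complex"
  assumes M: "finite_measure M" and N: "finite_measure N"
    and XY[measurable]: "X \<in> borel_measurable M" "Y \<in> borel_measurable N"
    and hk[measurable]: "h \<in> borel_measurable M" "k \<in> borel_measurable N"
    and fg[measurable]: "f \<in> borel_measurable M" "g \<in> borel_measurable N"
    and f: "\<And>x. norm (f x) \<le> h x" "\<And>x. h x \<le> B" and g: "\<And>y. norm (g y) \<le> k y" "\<And>y. k y \<le> B"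
    and eq1: "\<And>u. (CLINT x|M. iexp (u * X x) * h x) = (CLINT y|N. iexp (u * Y y) * k y)"
    and eq2: "\<And>u. (CLINT x|M. iexp (u * X x) * f x) = (CLINT y|N. iexp (u * Y y) * g y)"
    and eq3: "\<And>u. (CLINT x|M. iexp (u * X x) * cnj (f x)) = (CLINT y|N. iexp (u * Y y) * cnj (g y))"
    and A[measurable]: "A \<in> sets borel"
  shows "(CLINT x|M. indicator A (X x) * f x) = (CLINT y|N. indicator A (Y y) * g y)"
proof -
  interpret M: finite_measure M by fact
  interpret N: finite_measure N by fact
  have h0: "0 \<le> h x" for x using order_trans[OF norm_ge_zero f(1)] .
  have k0: "0 \<le> k x" for x using order_trans[OF norm_ge_zero g(1)] .
  have bM: "complex_integrable M F" if "F \<in> borel_measurable M" "\<And>x. norm (F x) \<le> 2 * h x" for F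
    by (rule M.integrable_const_bound[where B="2 * B"])
       (use that f(2) in \<open>auto intro!: AE_I2 intro: order_trans[OF that(2)]\<close>)
  have bN: "complex_integrable N F" if "F \<in> borel_measurable N" "\<And>x. norm (F x) \<le> 2 * k x" for F
    by (rule N.integrable_const_bound[where B="2 * B"])
       (use that g(2) in \<open>auto intro!: AE_I2 intro: order_trans[OF that(2)]\<close>)
  have rM: "integrable M F" if "F \<in> borel_measurable M" "\<And>x. \<bar>F x\<bar> \<le> 2 * h x" for F :: "'a \<Rightarrow> real"
    by (rule M.integrable_const_bound[where B="2 * B"])
       (use that f(2) in \<open>auto intro!: AE_I2 intro: order_trans[OF that(2)]\<close>)
  have rN: "integrable N F" if "F \<in> borel_measurable N" "\<And>x. \<bar>F x\<bar> \<le> 2 * k x" for F :: "'b \<Rightarrow> real"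
    by (rule N.integrable_const_bound[where B="2 * B"])
       (use that g(2) in \<open>auto intro!: AE_I2 intro: order_trans[OF that(2)]\<close>)
  have ff: "norm (f x) \<le> 2 * h x" "\<bar>h x\<bar> \<le> 2 * h x" "\<bar>Re (f x)\<bar> \<le> h x" "\<bar>Im (f x)\<bar> \<le> h x" for x
    using f(1)[of x] h0[of x] abs_Re_le_cmod[of "f x"] abs_Im_le_cmod[of "f x"] by auto
  have gg: "norm (g x) \<le> 2 * k x" "\<bar>k x\<bar> \<le> 2 * k x" "\<bar>Re (g x)\<bar> \<le> k x" "\<bar>Im (g x)\<bar> \<le> k x" for x
    using g(1)[of x] k0[of x] abs_Re_le_cmod[of "g x"] abs_Im_le_cmod[of "g x"] by auto
  \<comment> \<open>Real and imaginary parts are combinations of \<open>z\<close> and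
    \<open>cnj z\<close>; this is where the separate hypothesis \<open>eq3\<close> on the conjugate
    weights enters.\<close>
  have Re_decomp: "e * complex_of_real (r + Re z) = e * r + (e * z / 2 + e * cnj z / 2)"
    for e z :: complex and r
    by (simp add: complex_eq_iff field_simps)
  have Im_decomp: "e * complex_of_real (r + Im z) = e * r + (- \<i> / 2) * (e * z) + (\<i> / 2) * (e * cnj z)"
    for e z :: complex and r
    by (simp add: complex_eq_iff field_simps)
  have [measurable]: "(\<lambda>x. cnj (f x)) \<in> borel_measurable M" "(\<lambda>x. cnj (g x)) \<in> borel_measurable N"
    by (auto intro!: measurable_compose[OF fg(1)] measurable_compose[OF fg(2)]
        borel_measurable_continuous_onI continuous_intros)
  have i: "complex_integrable M (\<lambda>x. iexp (u * X x) * h x)" "complex_integrable M (\<lambda>x. iexp (u * X x) * f x)"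
     "complex_integrable M (\<lambda>x. iexp (u * X x) * cnj (f x))" for u
    by (rule bM; simp add: norm_mult ff del: of_real_mult)+
  have j: "complex_integrable N (\<lambda>x. iexp (u * Y x) * k x)" "complex_integrable N (\<lambda>x. iexp (u * Y x) * g x)"
     "complex_integrable N (\<lambda>x. iexp (u * Y x) * cnj (g x))" for u
    by (rule bN; simp add: norm_mult gg del: of_real_mult)+
  have e1: "(LINT x|M. indicator A (X x) * h x) = (LINT x|N. indicator A (Y x) * k x)"
    by (rule weighted_indicator_eq_of_weighted_char_eq[OF M N XY hk _ _ _ _ eq1 A, where B="B"])
       (use f(2) g(2) h0 k0 in auto)
  have e2: "(LINT x|M. indicator A (X x) * (h x + Re (f x))) = (LINT x|N. indicator A (Y x) * (k x + Re (g x)))"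
  proof (rule weighted_indicator_eq_of_weighted_char_eq[OF M N XY _ _ _ _ _ _ _ A, where B="2 * B"])
    show "0 \<le> h x + Re (f x)" "h x + Re (f x) \<le> 2 * B" for x using ff(3)[of x] f(2)[of x] by auto
    show "0 \<le> k x + Re (g x)" "k x + Re (g x) \<le> 2 * B" for x using gg(3)[of x] g(2)[of x] by auto
    show "(CLINT x|M. iexp (u * X x) * complex_of_real (h x + Re (f x))) =
         (CLINT y|N. iexp (u * Y y) * complex_of_real (k y + Re (g y)))" for u
      unfolding Re_decomp using i[of u] j[of u] eq1[of u] eq2[of u] eq3[of u] by simp
  qed auto
  have e3: "(LINT x|M. indicator A (X x) * (h x + Im (f x))) = (LINT x|N. indicator A (Y x) * (k x + Im (g x)))"
  proof (rule weighted_indicator_eq_of_weighted_char_eq[OF M N XY _ _ _ _ _ _ _ A, where B="2 * B"])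
    show "0 \<le> h x + Im (f x)" "h x + Im (f x) \<le> 2 * B" for x using ff(4)[of x] f(2)[of x] by auto
    show "0 \<le> k x + Im (g x)" "k x + Im (g x) \<le> 2 * B" for x using gg(4)[of x] g(2)[of x] by auto
    show "(CLINT x|M. iexp (u * X x) * complex_of_real (h x + Im (f x))) =
         (CLINT y|N. iexp (u * Y y) * complex_of_real (k y + Im (g y)))" for u
      unfolding Im_decomp using i[of u] j[of u] eq1[of u] eq2[of u] eq3[of u] by simp
  qed auto
  have iM: "integrable M (\<lambda>x. indicator A (X x) * h x)" "integrable M (\<lambda>x. indicator A (X x) * Re (f x))"
       "integrable M (\<lambda>x. indicator A (X x) * Im (f x))"
    by (rule rM; use ff h0 in \<open>auto simp: indicator_def intro: order_trans[OF ff(3)] order_trans[OF ff(4)]\<close>)+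
  have iN: "integrable N (\<lambda>x. indicator A (Y x) * k x)" "integrable N (\<lambda>x. indicator A (Y x) * Re (g x))"
       "integrable N (\<lambda>x. indicator A (Y x) * Im (g x))"
    by (rule rN; use gg k0 in \<open>auto simp: indicator_def intro: order_trans[OF gg(3)] order_trans[OF gg(4)]\<close>)+
  have re: "(LINT x|M. indicator A (X x) * Re (f x)) = (LINT x|N. indicator A (Y x) * Re (g x))"
    using e1 e2 iM iN by (simp add: distrib_left)
  have im: "(LINT x|M. indicator A (X x) * Im (f x)) = (LINT x|N. indicator A (Y x) * Im (g x))"
    using e1 e3 iM iN by (simp add: distrib_left)
  have cM: "complex_integrable M (\<lambda>x. indicator A (X x) * f x)"
    by (rule bM; use ff(1) h0 in \<open>auto simp: indicator_def\<close>)
  have cN: "complex_integrable N (\<lambda>x. indicator A (Y x) * g x)"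
    by (rule bN; use gg(1) k0 in \<open>auto simp: indicator_def\<close>)
  have ind: "Re (indicator S x * z) = indicator S x * Re z" "Im (indicator S x * z) = indicator S x * Im z"
    for S and x :: real and z :: complex by (auto simp: indicator_def)
  show ?thesis
    by (rule complex_eqI)
       (use re im in \<open>simp_all only: integral_Re[OF cM, symmetric] integral_Im[OF cM, symmetric]
          integral_Re[OF cN, symmetric] integral_Im[OF cN, symmetric] ind\<close>)
qed

text \<open>Induction on the set \<open>S\<close> of coordinates already turned into indicators. The
  frequencies \<open>a\<close> stay arbitrary, so the induction hypothesis contains all frequencies
  of the next coordinate, and one-dimensional uniqueness applies to it with the remaining factors as
  a complex weight.\<close>

lemma Cramer_Wold_rectangles:
  fixes X :: "'i \<Rightarrow> 'a \<Rightarrow> real" and Y :: "'i \<Rightarrow> 'b \<Rightarrow> real"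
  assumes M: "finite_measure M" and N: "finite_measure N" and J: "finite J"
    and X: "\<And>j. j \<in> J \<Longrightarrow> X j \<in> borel_measurable M"
    and Y: "\<And>j. j \<in> J \<Longrightarrow> Y j \<in> borel_measurable N"
    and eq: "\<And>a. (CLINT x|M. iexp (\<Sum>j\<in>J. a j * X j x)) = (CLINT y|N. iexp (\<Sum>j\<in>J. a j * Y j y))"
    and A: "\<And>j. j \<in> J \<Longrightarrow> A j \<in> sets borel"
    and S: "S \<subseteq> J"
  shows "(CLINT x|M. complex_of_real (\<Prod>j\<in>S. indicator (A j) (X j x)) * iexp (\<Sum>j\<in>J - S. a j * X j x)) =
         (CLINT y|N. complex_of_real (\<Prod>j\<in>S. indicator (A j) (Y j y)) * iexp (\<Sum>j\<in>J - S. a j * Y j y))"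
  using finite_subset[OF S J] S
proof (induction S arbitrary: a rule: finite_induct)
  case empty
  then show ?case using eq by simp
next
  case (insert s S)
  have sJ: "s \<in> J" "s \<notin> S" "S \<subseteq> J" using insert by auto
  have J': "J - S = insert s (J - insert s S)" using sJ by auto
  have fin: "finite (J - insert s S)" using J by simp
  let ?pX = "\<lambda>x. \<Prod>j\<in>S. indicator (A j) (X j x) :: real"
  let ?pY = "\<lambda>x. \<Prod>j\<in>S. indicator (A j) (Y j x) :: real"
  let ?eX = "\<lambda>x. iexp (\<Sum>j\<in>J - insert s S. a j * X j x)"
  let ?eY = "\<lambda>x. iexp (\<Sum>j\<in>J - insert s S. a j * Y j x)"
  note [measurable] = X[OF sJ(1)] Y[OF sJ(1)]
  have [measurable]: "X j \<in> borel_measurable M" "Y j \<in> borel_measurable N" "A j \<in> sets borel"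
    if "j \<in> S" for j using that X Y A insert.prems by auto
  have mX: "?pX \<in> borel_measurable M" "?pY \<in> borel_measurable N" by measurable
  note [measurable] = mX
  have [measurable]: "X j \<in> borel_measurable M" "Y j \<in> borel_measurable N"
    if "j \<in> J - insert s S" for j using that X Y by auto
  have p: "0 \<le> ?pX x" "?pX x \<le> 1" "0 \<le> ?pY y" "?pY y \<le> 1" for x y
    by (auto intro!: prod_nonneg prod_le_1)
  \<comment> \<open>Setting the frequency at \<open>s\<close> to \<open>u\<close> isolates
    \<open>X s\<close>, whose weighted characteristic function is then read off from the induction
    hypothesis.\<close>
  have sum_upd: "(\<Sum>j\<in>J - S. (b(s := u)) j * Z j) = u * Z s + (\<Sum>j\<in>J - insert s S. b j * Z j)"
    for b u and Z :: "'i \<Rightarrow> real"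
    unfolding J' using fin by (subst sum.insert) (auto intro!: sum.cong)
  have IH: "(CLINT x|M. iexp (u * X s x) * (complex_of_real (?pX x) * iexp (\<Sum>j\<in>J - insert s S. b j * X j x))) =
        (CLINT x|N. iexp (u * Y s x) * (complex_of_real (?pY x) * iexp (\<Sum>j\<in>J - insert s S. b j * Y j x)))" for u b
    using insert.IH[of "b(s := u)"] sJ unfolding sum_upd
    by (simp add: exp_add distrib_left mult_ac)
  have "(CLINT x|M. indicator (A s) (X s x) * (complex_of_real (?pX x) * ?eX x)) =
        (CLINT x|N. indicator (A s) (Y s x) * (complex_of_real (?pY x) * ?eY x))"
  proof (rule complex_weighted_indicator_eq_of_weighted_char_eq[OF M N, where h="?pX" and k="?pY" and B=1])
    show "(CLINT x|M. iexp (u * X s x) * complex_of_real (?pX x)) =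
        (CLINT x|N. iexp (u * Y s x) * complex_of_real (?pY x))" for u
      using IH[of u "\<lambda>_. 0"] by simp
    \<comment> \<open>The indicators are real, so conjugating the weight only negates the remaining
      frequencies.\<close>
    show "(CLINT x|M. iexp (u * X s x) * cnj (complex_of_real (?pX x) * ?eX x)) =
        (CLINT x|N. iexp (u * Y s x) * cnj (complex_of_real (?pY x) * ?eY x))" for u
      using IH[of u "\<lambda>j. - a j"] by (simp add: exp_cnj sum_negf)
  qed (use IH A[OF sJ(1)] p in \<open>auto simp: norm_mult simp del: of_real_prod of_real_sum of_real_mult\<close>)
  then show ?case
    using insert.hyps by (simp add: mult.assoc of_real_indicator)
qed

text \<open>For \<open>S = J\<close> no exponential is left and the two laws agree on measurable
  rectangles, which determine a finite measure on a finite product.\<close>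

theorem Cramer_Wold:
  fixes X :: "'i \<Rightarrow> 'a \<Rightarrow> real" and Y :: "'i \<Rightarrow> 'b \<Rightarrow> real"
  assumes M: "finite_measure M" and N: "finite_measure N" and J: "finite J"
    and X: "\<And>j. j \<in> J \<Longrightarrow> X j \<in> borel_measurable M"
    and Y: "\<And>j. j \<in> J \<Longrightarrow> Y j \<in> borel_measurable N"
    and eq: "\<And>a. (CLINT x|M. iexp (\<Sum>j\<in>J. a j * X j x)) = (CLINT y|N. iexp (\<Sum>j\<in>J. a j * Y j y))"
  shows "distr M (\<Pi>\<^sub>M j\<in>J. borel) (\<lambda>x. \<lambda>j\<in>J. X j x) = distr N (\<Pi>\<^sub>M j\<in>J. borel) (\<lambda>y. \<lambda>j\<in>J. Y j y)"
    (is "?P = ?Q")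
proof (rule measure_eqI_PiM_finite[OF J])
  interpret M: finite_measure M by fact
  interpret N: finite_measure N by fact
  have mX: "(\<lambda>x. \<lambda>j\<in>J. X j x) \<in> measurable M (\<Pi>\<^sub>M j\<in>J. borel)"
    by (intro measurable_restrict X)
  have mY: "(\<lambda>x. \<lambda>j\<in>J. Y j x) \<in> measurable N (\<Pi>\<^sub>M j\<in>J. borel)"
    by (intro measurable_restrict Y)
  show "emeasure ?P (Pi\<^sub>E J A) = emeasure ?Q (Pi\<^sub>E J A)" if A: "\<And>j. j \<in> J \<Longrightarrow> A j \<in> sets borel" for A
  proof -
    have "(\<Prod>j\<in>J. indicator (A j) (Z j) :: real) = indicator (Pi\<^sub>E J A) (\<lambda>j\<in>J. Z j)" for Z
      using J by (auto simp: indicator_def PiE_iff)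
    then have "(CLINT x|M. complex_of_real (indicator (Pi\<^sub>E J A) (\<lambda>j\<in>J. X j x))) =
        (CLINT y|N. complex_of_real (indicator (Pi\<^sub>E J A) (\<lambda>j\<in>J. Y j y)))"
      using Cramer_Wold_rectangles[where A=A and S=J and a="\<lambda>_. 0", OF M N J X Y eq A order_refl]
      by (simp del: of_real_prod)
    then have eq': "(LINT x|M. indicat_real (Pi\<^sub>E J A) (\<lambda>j\<in>J. X j x)) = (LINT y|N. indicat_real (Pi\<^sub>E J A) (\<lambda>j\<in>J. Y j y))"
      by (simp only: integral_complex_of_real of_real_eq_iff)
    have sA: "Pi\<^sub>E J A \<in> sets (\<Pi>\<^sub>M j\<in>J. borel)" using J A by (intro sets_PiM_I_finite) auto
    have "(LINT x|?P. indicat_real (Pi\<^sub>E J A) x) = (LINT x|?Q. indicat_real (Pi\<^sub>E J A) x)"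
      using eq' sA by (subst (1 2) integral_distr) (auto intro: mX mY)
    then have "measure ?P (Pi\<^sub>E J A) = measure ?Q (Pi\<^sub>E J A)"
      using sA sets.sets_into_space[OF sA] by (simp add: Int_absorb1)
    then show ?thesis
      using finite_measure.emeasure_eq_measure[OF M.finite_measure_distr[OF mX]]
        finite_measure.emeasure_eq_measure[OF N.finite_measure_distr[OF mY]] by simp
  qed
  show "range (\<lambda>_::nat. \<Pi>\<^sub>E j\<in>J. UNIV) \<subseteq> prod_algebra J (\<lambda>_. borel :: real measure)"
    using J by (auto intro!: prod_algebraI_finite)
  show "emeasure ?P (\<Pi>\<^sub>E j\<in>J. UNIV) \<noteq> \<infinity>" 
    using finite_measure.emeasure_finite[OF M.finite_measure_distr[OF mX]] by simp
qed (auto simp: space_PiM)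

section \<open>Bochner's theorem\<close>

lemma (in real_distribution) Gaussian_average_char:
  "(CLINT z|std_normal_distribution. char M (s * z)) = complex_of_real (LINT x|M. exp (- (s * x)\<^sup>2 / 2))"
proof -
  interpret Z: real_distribution std_normal_distribution by (rule real_dist_normal_dist)
  interpret P: pair_prob_space M std_normal_distribution ..
  have [measurable]: "(\<lambda>(x, z). iexp (s * z * x)) \<in> borel_measurable (M \<Otimes>\<^sub>M std_normal_distribution)"
    by measurable
  have int: "complex_integrable (M \<Otimes>\<^sub>M std_normal_distribution) (\<lambda>(x, z). iexp (s * z * x))"
    by (rule P.integrable_const_bound[where B=1]) auto
  have "(CLINT z|std_normal_distribution. char M (s * z)) =
      (CLINT x|M. (CLINT z|std_normal_distribution. iexp (s * z * x)))"
    unfolding char_def by (rule P.Fubini_integral[OF int])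
  also have "\<dots> = (CLINT x|M. char std_normal_distribution (s * x))"
    unfolding char_def by (simp add: mult_ac)
  also have "\<dots> = complex_of_real (LINT x|M. exp (- (s * x)\<^sup>2 / 2))"
    by (simp only: char_std_normal_distribution integral_complex_of_real)
  finally show ?thesis .
qed

text \<open>By Fubini the Gaussian average of the characteristic function is the mean of exp
  (-(x/k)^2 / 2). Outside the interval (x/k)^2 is at least 1, so the defect from 1 is at least 1 -
  exp (-1/2) there. The Gaussian weight replaces the uniform average of the classical truncation
  inequality.\<close>

lemma (in real_distribution) tail_le_Gaussian_average_char:
  assumes k: "k > 0"
  shows "(1 - exp (-1/2)) * (1 - prob {-k<..k}) \<le>
    1 - Re (CLINT z|std_normal_distribution. char M (z / k))"
proof -
  let ?g = "\<lambda>x. exp (- ((1 / k) * x)\<^sup>2 / 2)"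
  have compl: "1 - prob {-k<..k} = prob (UNIV - {-k<..k})"
    using prob_compl[of "{-k<..k}"] by simp
  have intg: "integrable M ?g"
    by (rule integrable_const_bound[where B=1]) auto
  have "(1 - exp (-1/2)) * (1 - prob {-k<..k}) = (LINT x|M. (1 - exp (-1/2)) * indicator (UNIV - {-k<..k}) x)"
    unfolding compl by simp
  also have "\<dots> \<le> (LINT x|M. 1 - ?g x)"
  proof (rule integral_mono)
    show "(1 - exp (-1/2)) * indicator (UNIV - {-k<..k}) x \<le> 1 - ?g x" for x
    proof (cases "x \<in> {-k<..k}")
      case False
      then have "1 \<le> \<bar>x / k\<bar>" using k by (auto simp: field_simps abs_if)
      then have "1 \<le> (x / k)\<^sup>2" by (metis abs_le_square_iff abs_one one_power2)
      then show ?thesis using False by simp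
    qed simp
  qed (use intg in \<open>auto intro!: integrable_real_indicator simp: emeasure_eq_measure\<close>)
  also have "\<dots> = 1 - (LINT x|M. ?g x)"
    using intg prob_space by simp
  also have "(LINT x|M. ?g x) = Re (CLINT z|std_normal_distribution. char M (z / k))"
    using Gaussian_average_char[of "1 / k"] by simp
  finally show ?thesis .
qed

text \<open>Gaussian averages of \<open>\<psi>\<close> at scale 1/k tend to
  \<open>\<psi> 0 = 1\<close> by continuity at 0. Fixing one good \<open>k\<close>, dominated
  convergence carries the estimate to all large \<open>n\<close>; the finitely many remaining
  measures are tight individually.\<close>

lemma tight_of_char_tendsto:
  fixes \<mu> :: "nat \<Rightarrow> real measure"
  assumes \<mu>: "\<And>n. real_distribution (\<mu> n)"
    and conv: "\<And>t. (\<lambda>n. char (\<mu> n) t) \<longlonglongrightarrow> \<psi> t" and cont: "isCont \<psi> 0"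
  shows "tight \<mu>"
  unfolding tight_def
proof (intro conjI allI impI \<mu>)
  interpret \<mu>: real_distribution "\<mu> n" for n by fact
  interpret Z: real_distribution std_normal_distribution by (rule real_dist_normal_dist)
  fix \<epsilon> :: real assume \<epsilon>: "\<epsilon> > 0"
  have [measurable]: "\<psi> \<in> borel_measurable borel"
    by (rule borel_measurable_LIMSEQ_metric[OF \<mu>.char_measurable conv])
  have norm: "norm (\<psi> t) \<le> 1" for t
    by (rule LIMSEQ_le_const2[OF tendsto_norm[OF conv[of t]]]) (use \<mu>.cmod_char_le_1 in auto)
  have \<psi>0: "\<psi> 0 = 1"
    using LIMSEQ_unique[OF conv[of 0]] \<mu>.char_zero by simp
  define I where "I k = (CLINT z|std_normal_distribution. \<psi> (z / real k))" for k :: nat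
  have "I \<longlonglongrightarrow> (CLINT z|std_normal_distribution. 1)"
    unfolding I_def
  proof (rule integral_dominated_convergence[where w="\<lambda>_. 1"])
    show "AE z in std_normal_distribution. (\<lambda>k. \<psi> (z / real k)) \<longlonglongrightarrow> 1"
    proof (rule AE_I2)
      fix z :: real
      have "(\<lambda>k. z / real k) \<longlonglongrightarrow> 0" by (rule lim_const_over_n)
      from isCont_tendsto_compose[OF cont this] show "(\<lambda>k. \<psi> (z / real k)) \<longlonglongrightarrow> 1" by (simp add: \<psi>0)
    qed
  qed (auto simp: norm)
  then have "(\<lambda>k. Re (I k)) \<longlonglongrightarrow> 1"
    using Z.prob_space by (auto intro: tendsto_eq_intros)
  \<comment> \<open>The factor in the tail bound; aiming at the threshold
    \<open>1 - \<epsilon> * c\<close> makes the tail mass smaller than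
    \<open>\<epsilon>\<close>.\<close>
  define c where "c = 1 - exp (-1/2 :: real)"
  have c: "c > 0" by (simp add: c_def)
  have "eventually (\<lambda>k. Re (I k) > 1 - \<epsilon> * c \<and> k > 0) sequentially"
    using \<open>(\<lambda>k. Re (I k)) \<longlonglongrightarrow> 1\<close> c \<epsilon>
    by (intro eventually_conj order_tendstoD eventually_gt_at_top) (auto intro: order_tendstoD)
  then obtain k where k: "Re (I k) > 1 - \<epsilon> * c" "k > 0"
    by (auto simp: eventually_sequentially)
  have "(\<lambda>n. CLINT z|std_normal_distribution. char (\<mu> n) (z / real k)) \<longlonglongrightarrow> I k"
    unfolding I_def
    by (rule integral_dominated_convergence[where w="\<lambda>_. 1"]) (auto simp: conv \<mu>.cmod_char_le_1)
  then have "(\<lambda>n. Re (CLINT z|std_normal_distribution. char (\<mu> n) (z / real k))) \<longlonglongrightarrow> Re (I k)"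
    by (rule tendsto_Re)
  then have "eventually (\<lambda>n. Re (CLINT z|std_normal_distribution. char (\<mu> n) (z / real k)) > 1 - \<epsilon> * c) sequentially"
    using k(1) by (rule order_tendstoD)
  then obtain n0 where n0: "Re (CLINT z|std_normal_distribution. char (\<mu> n) (z / real k)) > 1 - \<epsilon> * c"
    if "n \<ge> n0" for n by (auto simp: eventually_sequentially)
  have large: "measure (\<mu> n) {- real k<..real k} > 1 - \<epsilon>" if "n \<ge> n0" for n
  proof -
    have "c * (1 - measure (\<mu> n) {- real k<..real k}) < c * \<epsilon>"
      using \<mu>.tail_le_Gaussian_average_char[of "real k" n] n0[OF that] k(2)
      unfolding c_def[symmetric] of_nat_0_less_iff mult.commute[of \<epsilon> c] by linarith
    then show ?thesis using c by simp
  qed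
  have "eventually (\<lambda>l. measure (\<mu> n) {- real l<..real l} > 1 - \<epsilon>) sequentially" for n
  proof -
    have U: "(\<Union>l. {- real l<..real l}) = UNIV"
      by (auto, metis leI le_less_trans less_imp_le minus_less_iff reals_Archimedean2)
    have "(\<lambda>l. measure (\<mu> n) {- real l<..real l}) \<longlonglongrightarrow> measure (\<mu> n) (\<Union>l. {- real l<..real l})"
      by (rule \<mu>.finite_Lim_measure_incseq) (auto simp: incseq_def)
    then have "(\<lambda>l. measure (\<mu> n) {- real l<..real l}) \<longlonglongrightarrow> 1"
      unfolding U using \<mu>.prob_space[of n] by simp
    then show ?thesis using \<epsilon> by (intro order_tendstoD) auto
  qed
  then have "eventually (\<lambda>l. (\<forall>n\<in>{..<n0}. measure (\<mu> n) {- real l<..real l} > 1 - \<epsilon>) \<and> l \<ge> k) sequentially"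
    by (intro eventually_conj eventually_ball_finite eventually_ge_at_top) auto
  then obtain l where l: "\<And>n. n < n0 \<Longrightarrow> measure (\<mu> n) {- real l<..real l} > 1 - \<epsilon>" "l \<ge> k"
    by (auto simp: eventually_sequentially)
  have "measure (\<mu> n) {- real l<..real l} > 1 - \<epsilon>" for n
  proof (cases "n < n0")
    case False
    have "measure (\<mu> n) {- real k<..real k} \<le> measure (\<mu> n) {- real l<..real l}"
      using l(2) by (intro \<mu>.finite_measure_mono) auto
    then show ?thesis using large[of n] False by simp
  qed (use l in auto)
  then show "\<exists>a b. a < b \<and> (\<forall>n. 1 - \<epsilon> < measure (\<mu> n) {a<..b})"
    using l(2) k(2) by (intro exI[of _ "- real l"] exI[of _ "real l"]) auto
qed

text \<open>Tightness yields a weakly convergent subsequence. The characteristic function of its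
  limit must be \<open>\<psi>\<close>, because the whole sequence of characteristic functions
  already converges to \<open>\<psi>\<close>.\<close>

theorem Levy_continuity_exists:
  fixes \<mu> :: "nat \<Rightarrow> real measure"
  assumes \<mu>: "\<And>n. real_distribution (\<mu> n)"
    and conv: "\<And>t. (\<lambda>n. char (\<mu> n) t) \<longlonglongrightarrow> \<psi> t" and cont: "isCont \<psi> 0"
  obtains \<nu> where "real_distribution \<nu>" "char \<nu> = \<psi>"
proof -
  have "tight \<mu>" by (rule tight_of_char_tendsto[OF \<mu> conv cont])
  then obtain r \<nu> where r: "strict_mono (r :: nat \<Rightarrow> nat)" and \<nu>: "real_distribution \<nu>"
    and w: "weak_conv_m (\<mu> \<circ> id \<circ> r) \<nu>"
    using tight_imp_convergent_subsubsequence[of \<mu> id] by (auto simp: strict_mono_def)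
  have "char \<nu> t = \<psi> t" for t
  proof (rule LIMSEQ_unique)
    show "(\<lambda>n. char (\<mu> (r n)) t) \<longlonglongrightarrow> char \<nu> t"
      using levy_continuity1[OF _ \<nu> w, of t] \<mu> by (simp add: comp_def)
    show "(\<lambda>n. char (\<mu> (r n)) t) \<longlonglongrightarrow> \<psi> t"
      using LIMSEQ_subseq_LIMSEQ[OF conv r] by (simp add: comp_def)
  qed
  then show thesis using that \<nu> by blast
qed

section \<open>Fejer means on one period\<close>

lemma integral_iexp_int_period:
  fixes n :: int
  shows "(CLINT x|lborel. indicator {-pi..pi} x *\<^sub>R iexp (n * x)) = (if n = 0 then 2 * pi else 0)"
proof (cases "n = 0")
  case True
  then show ?thesis by (simp add: scaleR_conv_of_real)
next
  case False
  have "(CLINT x|lborel. indicator {-pi..pi} x *\<^sub>R iexp (n * x)) =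
      iexp (n * pi) / (\<i> * n) - iexp (n * (- pi)) / (\<i> * n)"
    by (rule integral_FTC_Icc[where F="\<lambda>x. iexp (n * x) / (\<i> * n)"])
       (use False in \<open>auto intro!: derivative_eq_intros continuous_intros
         simp: has_vector_derivative_complex_iff Re_exp Im_exp Re_divide Im_divide field_simps power2_eq_square\<close>)
  also have "iexp (n * pi) = iexp (n * (- pi))"
    by (simp add: complex_eq_iff Re_exp Im_exp sin_integer_2pi)
       (simp add: mult.commute[of _ pi])
  finally show ?thesis using False by simp
qed

text \<open>Euler's formula splits the cosine into the frequencies \<open>n\<close> and
  \<open>- n\<close>. Both summands count when \<open>n\<close> and \<open>k\<close> are 0, giving 2
  \<pi>.\<close>

lemma integral_cos_iexp_int_period:
  fixes n k :: int
  shows "(CLINT x|lborel. indicator {-pi..pi} x *\<^sub>R (cos (n * x) * iexp (k * x))) =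
    pi * ((if n = k then 1 else 0) + (if n = - k then 1 else 0))"
proof -
  have eq: "complex_of_real (cos (n * x)) * iexp (k * x) =
      (iexp (real_of_int (k + n) * x) + iexp (real_of_int (k - n) * x)) / 2" for x :: real
    by (simp add: complex_eq_iff Re_exp Im_exp cos_add cos_diff sin_add sin_diff algebra_simps)
  have "(CLINT x|lborel. indicator {-pi..pi} x *\<^sub>R (cos (n * x) * iexp (k * x))) =
    (CLINT x|lborel. (indicator {-pi..pi} x *\<^sub>R iexp (real_of_int (k + n) * x) +
       indicator {-pi..pi} x *\<^sub>R iexp (real_of_int (k - n) * x)) / 2)"
    unfolding eq by (intro Bochner_Integration.integral_cong refl) (simp add: scaleR_conv_of_real field_simps)
  also have "\<dots> = ((CLINT x|lborel. indicator {-pi..pi} x *\<^sub>R iexp (real_of_int (k + n) * x)) +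
      (CLINT x|lborel. indicator {-pi..pi} x *\<^sub>R iexp (real_of_int (k - n) * x))) / 2"
    by (subst integral_divide_zero, subst Bochner_Integration.integral_add)
       (auto intro!: borel_integrable_compact continuous_intros)
  also have "\<dots> = pi * ((if n = k then 1 else 0) + (if n = - k then 1 else 0))"
    unfolding integral_iexp_int_period by auto
  finally show ?thesis .
qed

text \<open>The k-th diagonal of an N by N Toeplitz matrix has N - k entries; divided by N this
  becomes the Fejer factor 1 - k/N.\<close>

lemma sum_Toeplitz_diagonal:
  fixes r :: "int \<Rightarrow> 'a :: {semiring_1, comm_monoid_add}"
  assumes "k \<le> N"
  shows "(\<Sum>j<N. \<Sum>l<N. r (int j - int l) * (if int j - int l = int k then 1 else 0)) = of_nat (N - k) * r (int k)"
proof -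
  have "(\<Sum>l<N. r (int j - int l) * (if int j - int l = int k then 1 else 0)) = (if k \<le> j then r (int k) else 0)"
    if "j < N" for j
  proof -
    \<comment> \<open>Subtraction on naturals truncates: for \<open>j < k\<close> the index
      \<open>j - k\<close> is 0, and the guard \<open>k \<le> j\<close> removes that spurious
      term.\<close>
    have "(\<Sum>l<N. r (int j - int l) * (if int j - int l = int k then 1 else 0)) =
        (\<Sum>l<N. if l = j - k then (if k \<le> j then r (int k) else 0) else 0)"
      by (intro sum.cong refl) auto
    also have "\<dots> = (if k \<le> j then r (int k) else 0)"
      using that by (subst sum.delta) auto
    finally show ?thesis .
  qed
  then have "(\<Sum>j<N. \<Sum>l<N. r (int j - int l) * (if int j - int l = int k then 1 else 0)) =
      (\<Sum>j<N. if k \<le> j then r (int k) else 0)" by simp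
  also have "\<dots> = (\<Sum>j\<in>{k..<N}. r (int k))"
    by (rule sum.mono_neutral_cong_right) auto
  finally show ?thesis by simp
qed

text \<open>The \<open>N\<close>-th Fejer mean of the Fourier series of \<open>r\<close> is a nonnegative density.\<close>

lemma Fejer_measure:
  fixes r :: "int \<Rightarrow> real"
  assumes N: "N > 0" and r0: "r 0 = 1" and even: "\<And>k. r (- k) = r k"
    and pos: "\<And>a. 0 \<le> (\<Sum>j<N. \<Sum>l<N. a j * a l * r (int j - int l))"
  obtains \<mu> where "real_distribution \<mu>" "AE x in \<mu>. \<bar>x\<bar> \<le> pi"
    "\<And>k. k \<le> N \<Longrightarrow> char \<mu> (real k) = (1 - real k / real N) * r (int k)"
proof -
  \<comment> \<open>Up to the factor 1 / (2 \<pi> N) this is the Hermitian form of \<open>r\<close>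
    at the vector exp (i j x), written with real terms because \<open>r\<close> is even. The
    constant gives total mass \<open>r 0\<close>.\<close>
  define D where "D x = (\<Sum>j<N. \<Sum>l<N. r (int j - int l) * cos ((int j - int l) * x)) / (2 * pi * N)" for x :: real
  have [measurable]: "D \<in> borel_measurable borel" unfolding D_def[abs_def] by measurable
  have D0: "0 \<le> D x" for x
  proof -
    \<comment> \<open>The addition formula splits the form into its values at the real vectors cos
      (j x) and sin (j x), so positivity for real coefficients suffices.\<close>
    have "(\<Sum>j<N. \<Sum>l<N. r (int j - int l) * cos ((int j - int l) * x)) =
        (\<Sum>j<N. \<Sum>l<N. cos (j * x) * cos (l * x) * r (int j - int l)) +
        (\<Sum>j<N. \<Sum>l<N. sin (j * x) * sin (l * x) * r (int j - int l))"
      by (simp add: sum.distrib[symmetric] left_diff_distrib cos_diff algebra_simps)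
    also have "\<dots> \<ge> 0" using pos by (intro add_nonneg_nonneg) auto
    finally show ?thesis unfolding D_def by (intro divide_nonneg_nonneg) auto
  qed
  have D_iexp: "(CLINT x|lborel. indicator {-pi..pi} x *\<^sub>R (D x * iexp (k * x))) = (1 - real k / real N) * r (int k)"
    if k: "k \<le> N" for k :: nat
  proof -
    define F where "F j l x = (r (int j - int l) / (2 * pi * N)) *\<^sub>R
        (indicator {-pi..pi} x *\<^sub>R (cos (real_of_int (int j - int l) * x) * iexp (real_of_int (int k) * x)))"
      for j l and x :: real
    have intF: "integrable lborel (F j l)" for j l
      unfolding F_def by (intro integrable_scaleR_right borel_integrable_compact continuous_intros) auto
    have "indicator {-pi..pi} x *\<^sub>R (D x * iexp (k * x)) = (\<Sum>j<N. \<Sum>l<N. F j l x)" for x :: real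
      unfolding D_def F_def
      by (simp add: scaleR_conv_of_real sum_distrib_left sum_distrib_right sum_divide_distrib mult_ac)
    then have "(CLINT x|lborel. indicator {-pi..pi} x *\<^sub>R (D x * iexp (k * x))) =
        (\<Sum>j<N. \<Sum>l<N. (CLINT x|lborel. F j l x))"
      using intF by simp
    also have "\<dots> = (\<Sum>j<N. \<Sum>l<N. (r (int j - int l) / (2 * pi * N)) *\<^sub>R
        complex_of_real (pi * ((if int j - int l = int k then 1 else 0) + (if int j - int l = - int k then 1 else 0))))"
      unfolding F_def integral_scaleR_right integral_cos_iexp_int_period by simp
    also have "\<dots> = complex_of_real ((\<Sum>j<N. \<Sum>l<N. r (int j - int l) * (if int j - int l = int k then 1 else 0) +
        r (int j - int l) * (if int j - int l = - int k then 1 else 0)) / (2 * N))"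
      unfolding sum_divide_distrib of_real_sum
      by (intro sum.cong refl) (simp add: scaleR_conv_of_real field_simps)
    also have "(\<Sum>j<N. \<Sum>l<N. r (int j - int l) * (if int j - int l = int k then 1 else 0) +
        r (int j - int l) * (if int j - int l = - int k then 1 else 0)) = 2 * ((real N - real k) * r (int k))"
    proof -
      \<comment> \<open>Exchanging the two indices maps the diagonal - k to k, and \<open>r\<close>
        is even; the two equal contributions cancel the 2 in the denominator.\<close>
      have "(\<Sum>j<N. \<Sum>l<N. r (int j - int l) * (if int j - int l = - int k then 1 else 0)) =
          (\<Sum>l<N. \<Sum>j<N. r (int l - int j) * (if int l - int j = int k then 1 else 0))"
        using even[of "int l - int j" for j l] by (subst sum.swap, intro sum.cong refl) auto
      then show ?thesis
        using sum_Toeplitz_diagonal[OF k, of r] k by (simp add: sum.distrib of_nat_diff)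
    qed
    also have "complex_of_real (2 * ((real N - real k) * r (int k)) / (2 * N)) = (1 - real k / real N) * r (int k)"
      using N by (simp add: field_simps)
    finally show ?thesis .
  qed
  define \<mu> where "\<mu> = density lborel (\<lambda>x. ennreal (indicator {-pi..pi} x * D x))"
  have intD: "integrable lborel (\<lambda>x. indicator {-pi..pi} x * D x)"
  proof -
    have "continuous_on {-pi..pi} D"
      unfolding D_def[abs_def] using N by (intro continuous_intros) auto
    from borel_integrable_compact[OF _ this] show ?thesis by simp
  qed
  have "complex_of_real (LINT x|lborel. indicator {-pi..pi} x * D x) = 1"
    using D_iexp[of 0] r0 by (simp add: scaleR_conv_of_real flip: of_real_mult)
  then have "(LINT x|lborel. indicator {-pi..pi} x * D x) = 1" by (simp only: of_real_eq_1_iff)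
  then have "prob_space \<mu>"
    unfolding \<mu>_def using intD D0
    by (intro prob_spaceI) (simp add: emeasure_density nn_integral_eq_integral)
  then have 1: "real_distribution \<mu>"
    by (simp add: real_distribution_def real_distribution_axioms_def \<mu>_def)
  have 2: "AE x in \<mu>. \<bar>x\<bar> \<le> pi"
    unfolding \<mu>_def by (subst AE_density) (auto simp: indicator_def abs_le_iff)
  have 3: "char \<mu> (real k) = (1 - real k / real N) * r (int k)" if "k \<le> N" for k
    using D_iexp[OF that] D0 unfolding char_def \<mu>_def
    by (subst integral_density) (auto simp: scaleR_conv_of_real mult.assoc)
  show thesis using that 1 2 3 by blast
qed

text \<open>On the support \<open>[-\<pi>, \<pi>]\<close> the function \<open>w \<mapsto> cos (w x)\<close> decreases on \<open>[0, 1]\<close>, so the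
  oscillation of the characteristic function between grid points is controlled by its value at 1.\<close>

lemma (in real_distribution) norm_char_diff_le:
  assumes supp: "AE x in M. \<bar>x\<bar> \<le> pi" and w: "0 \<le> w" "w \<le> 1"
  shows "norm (char M (t + w) - char M t) \<le> sqrt (2 * (1 - Re (char M 1)))"
proof (rule real_le_rsqrt)
  let ?f = "\<lambda>x. norm (iexp (w * x) - 1)"
  have i: "complex_integrable M (\<lambda>x. iexp (u * x))" for u
    by (rule integrable_const_bound[where B=1]) auto
  have f2: "?f x \<le> 2" for x
    using norm_triangle_ineq4[of "iexp (w * x)" 1] by simp
  have intf: "integrable M ?f"
    by (rule integrable_const_bound[where B=2]) (use f2 in auto)
  have "(?f x)\<^sup>2 \<le> 4" for x
    using power_mono[OF f2, of x 2] by simp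
  then have intf2: "integrable M (\<lambda>x. (?f x)\<^sup>2)"
    by (intro integrable_const_bound[where B=4]) auto
  have intc: "integrable M (\<lambda>x. cos x)"
    by (rule integrable_const_bound[where B=1]) auto
  have "char M (t + w) - char M t = (CLINT x|M. iexp (t * x) * (iexp (w * x) - 1))"
  proof -
    have "iexp (t * x) * (iexp (w * x) - 1) = iexp ((t + w) * x) - iexp (t * x)" for x
      by (simp add: distrib_right distrib_left exp_add right_diff_distrib)
    then show ?thesis
      unfolding char_def using Bochner_Integration.integral_diff[OF i[of "t + w"] i[of t]] by simp
  qed
  also have "norm \<dots> \<le> (LINT x|M. norm (iexp (t * x) * (iexp (w * x) - 1)))"
    by (rule integral_norm_bound)
  also have "\<dots> = (LINT x|M. ?f x)" by (simp add: norm_mult del: of_real_mult)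
  finally have "(norm (char M (t + w) - char M t))\<^sup>2 \<le> (LINT x|M. ?f x)\<^sup>2"
    by (intro power_mono) auto
  \<comment> \<open>The square of a mean is at most the mean of the square because a variance is
    nonnegative.\<close>
  also have "\<dots> \<le> (LINT x|M. (?f x)\<^sup>2)"
    using variance_eq[OF intf intf2] variance_positive[of ?f] by simp
  also have "\<dots> \<le> (LINT x|M. 2 * (1 - cos x))"
  proof (rule integral_mono_AE)
    show "AE x in M. (?f x)\<^sup>2 \<le> 2 * (1 - cos x)"
      using supp
    proof eventually_elim
      case (elim x)
      have "cos \<bar>x\<bar> \<le> cos (w * \<bar>x\<bar>)"
        using elim w mult_left_le_one_le[of "\<bar>x\<bar>" w] by (intro cos_monotone_0_pi_le) auto
      also have "cos (w * \<bar>x\<bar>) = cos (w * x)" by (cases "x \<ge> 0") auto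
      finally have "cos x \<le> cos (w * x)" by (cases "x \<ge> 0") auto
      moreover have "(?f x)\<^sup>2 = 2 * (1 - cos (w * x))"
        using sin_cos_squared_add[of "w * x"]
        unfolding cmod_power2 by (simp add: Re_exp Im_exp power2_eq_square algebra_simps)
      ultimately show ?case by simp
    qed
  qed (use intf2 intc in auto)
  also have "\<dots> = 2 * (1 - Re (char M 1))"
    using intc i[of 1] prob_space by (simp add: char_def integral_Re[symmetric] Re_exp)
  finally show "(norm (char M (t + w) - char M t))\<^sup>2 \<le> 2 * (1 - Re (char M 1))" .
qed

section \<open>Bochner's theorem from dyadic grids\<close>

lemma tendsto_dyadic_floor:
  fixes t :: real
  assumes "t \<ge> 0"
  shows "(\<lambda>m. real (nat \<lfloor>t * 2 ^ m\<rfloor>) / 2 ^ m) \<longlonglongrightarrow> t"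
proof (rule tendsto_sandwich)
  have "(\<lambda>m. (1 / 2) ^ m :: real) \<longlonglongrightarrow> 0" by (rule LIMSEQ_power_zero) simp
  then show "(\<lambda>m. t - (1 / 2) ^ m) \<longlonglongrightarrow> t" by (auto intro: tendsto_eq_intros)
  show "\<forall>\<^sub>F m in sequentially. t - (1 / 2) ^ m \<le> real (nat \<lfloor>t * 2 ^ m\<rfloor>) / 2 ^ m"
  proof (rule always_eventually, rule allI)
    fix m :: nat
    have "t * 2 ^ m - 1 \<le> real (nat \<lfloor>t * 2 ^ m\<rfloor>)" by linarith
    then have "(t * 2 ^ m - 1) / 2 ^ m \<le> real (nat \<lfloor>t * 2 ^ m\<rfloor>) / 2 ^ m"
      by (rule divide_right_mono) simp
    then show "t - (1 / 2) ^ m \<le> real (nat \<lfloor>t * 2 ^ m\<rfloor>) / 2 ^ m"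
      by (simp add: diff_divide_distrib power_divide)
  qed
  show "\<forall>\<^sub>F m in sequentially. real (nat \<lfloor>t * 2 ^ m\<rfloor>) / 2 ^ m \<le> t"
    using assms by (intro always_eventually allI) (simp add: field_simps)
qed simp

text \<open>The Fejer order on the grid of mesh \<open>2 ^ -m\<close> is \<open>4 ^ m\<close>, so
  the grid reaches up to \<open>2 ^ m\<close>. A fixed time \<open>t\<close> has index about
  \<open>t * 2 ^ m\<close>, negligible against the order, and its damping factor tends to 1.\<close>

theorem Bochner_real:
  fixes \<phi> :: "real \<Rightarrow> real"
  assumes \<phi>0: "\<phi> 0 = 1" and even: "\<And>t. \<phi> (- t) = \<phi> t" and cont: "\<And>t. isCont \<phi> t"
    and pos: "\<And>N (a :: nat \<Rightarrow> real) x. 0 \<le> (\<Sum>j<N. \<Sum>l<N. a j * a l * \<phi> (x j - x l))"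
  obtains \<nu> where "real_distribution \<nu>" "\<And>t. char \<nu> t = complex_of_real (\<phi> t)"
proof -
  have "\<exists>\<mu>. real_distribution \<mu> \<and> (AE x in \<mu>. \<bar>x\<bar> \<le> pi) \<and>
      (\<forall>k\<le>4 ^ m. char \<mu> (real k) = (1 - real k / 4 ^ m) * \<phi> (k / 2 ^ m))" for m :: nat
  proof -
    have "0 \<le> (\<Sum>j<4 ^ m. \<Sum>l<4 ^ m. a j * a l * \<phi> (real_of_int (int j - int l) / 2 ^ m))" for a
      using pos[of a "\<lambda>j. real j / 2 ^ m" "4 ^ m"] by (simp add: diff_divide_distrib)
    then obtain \<mu> where "real_distribution \<mu>" "AE x in \<mu>. \<bar>x\<bar> \<le> pi"
      "\<And>k. k \<le> 4 ^ m \<Longrightarrow> char \<mu> (real k) = (1 - real k / real (4 ^ m)) * \<phi> (real_of_int (int k) / 2 ^ m)"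
      using Fejer_measure[of "4 ^ m" "\<lambda>k. \<phi> (real_of_int k / 2 ^ m)"] \<phi>0 even
      by (auto simp flip: minus_divide_left)
    then show ?thesis by (intro exI[of _ \<mu>]) auto
  qed
  then obtain \<mu> where \<mu>: "\<And>m. real_distribution (\<mu> m)" "\<And>m. AE x in \<mu> m. \<bar>x\<bar> \<le> pi"
    and ch: "\<And>m k. k \<le> 4 ^ m \<Longrightarrow> char (\<mu> m) (real k) = (1 - real k / 4 ^ m) * \<phi> (k / 2 ^ m)"
    by metis
  interpret \<mu>: real_distribution "\<mu> m" for m by (rule \<mu>)
  \<comment> \<open>Dilating by \<open>2 ^ m\<close> turns the grid index \<open>k\<close> into the
    real frequency \<open>k / 2 ^ m\<close>.\<close>
  define \<nu> where "\<nu> m = distr (\<mu> m) borel (\<lambda>x. 2 ^ m * x)" for m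
  have \<nu>: "real_distribution (\<nu> m)" for m
    unfolding \<nu>_def real_distribution_def real_distribution_axioms_def
    by (auto intro!: \<mu>.prob_space_distr)
  have char\<nu>: "char (\<nu> m) t = char (\<mu> m) (t * 2 ^ m)" for m t
    unfolding \<nu>_def char_def by (subst integral_distr) (auto simp: mult.assoc)
  have half: "(\<lambda>m. 1 / 2 ^ m :: real) \<longlonglongrightarrow> 0"
    using LIMSEQ_power_zero[of "1 / 2 :: real"] by (simp add: power_divide)
  have quarter: "(\<lambda>m. 1 / 4 ^ m :: real) \<longlonglongrightarrow> 0"
    using LIMSEQ_power_zero[of "1 / 4 :: real"] by (simp add: power_divide)
  have conv_nonneg: "(\<lambda>m. char (\<nu> m) t) \<longlonglongrightarrow> \<phi> t" if t: "t \<ge> 0" for t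
  proof -
    define k where "k m = nat \<lfloor>t * 2 ^ m\<rfloor>" for m :: nat
    have k: "(\<lambda>m. real (k m) / 2 ^ m) \<longlonglongrightarrow> t" unfolding k_def by (rule tendsto_dyadic_floor[OF t])
    have k2: "(\<lambda>m. real (k m) / 4 ^ m) \<longlonglongrightarrow> 0"
      using tendsto_mult[OF k half] by (simp add: power_mult_distrib[symmetric])
    define w where "w m = t * 2 ^ m - real (k m)" for m
    have w: "0 \<le> w m" "w m \<le> 1" for m
      using t unfolding w_def k_def by (auto, linarith+)
    \<comment> \<open>The characteristic function of \<open>\<mu> m\<close> is known only up to
      index \<open>4 ^ m\<close>, so the formula is available only for large
      \<open>m\<close>.\<close>
    have "eventually (\<lambda>m. real (k m) / 4 ^ m < 1) sequentially"
      using k2 by (rule order_tendstoD) simp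
    then have ev: "eventually (\<lambda>m. char (\<mu> m) (k m) = (1 - real (k m) / 4 ^ m) * \<phi> (k m / 2 ^ m)) sequentially"
    proof eventually_elim
      case (elim m)
      then have "real (k m) \<le> real (4 ^ m)" by (simp add: field_simps)
      then show ?case by (intro ch) (simp only: of_nat_le_iff)
    qed
    have "(\<lambda>m. (1 - real (k m) / 4 ^ m) * \<phi> (k m / 2 ^ m)) \<longlonglongrightarrow> (1 - 0) * \<phi> t"
      by (intro tendsto_intros k2 isCont_tendsto_compose[OF cont k])
    then have lim: "(\<lambda>m. char (\<mu> m) (k m)) \<longlonglongrightarrow> \<phi> t"
      using tendsto_cong[OF ev, of "complex_of_real (\<phi> t)"] by (simp only: tendsto_of_real_iff) simp
    \<comment> \<open>This is the characteristic function of \<open>\<mu> m\<close> at 1, which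
      governs the error of rounding \<open>t * 2 ^ m\<close> to an integer.\<close>
    have "(\<lambda>m. (1 - 1 / 4 ^ m) * \<phi> (1 / 2 ^ m)) \<longlonglongrightarrow> (1 - 0) * \<phi> 0"
      by (intro tendsto_intros quarter isCont_tendsto_compose[OF cont half])
    from tendsto_real_sqrt[OF tendsto_mult_left[OF tendsto_diff[OF tendsto_const this]]]
    have "(\<lambda>m. sqrt (2 * (1 - (1 - 1 / 4 ^ m) * \<phi> (1 / 2 ^ m)))) \<longlonglongrightarrow> sqrt (2 * (1 - (1 - 0) * \<phi> 0))" .
    then have bd: "(\<lambda>m. sqrt (2 * (1 - (1 - 1 / 4 ^ m) * \<phi> (1 / 2 ^ m)))) \<longlonglongrightarrow> 0"
      by (simp add: \<phi>0)
    have "(\<lambda>m. char (\<nu> m) t - char (\<mu> m) (k m)) \<longlonglongrightarrow> 0"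
    proof (rule Lim_null_comparison[OF _ bd], rule always_eventually, rule allI)
      fix m
      have 1: "char (\<mu> m) 1 = complex_of_real ((1 - 1 / 4 ^ m) * \<phi> (1 / 2 ^ m))"
        using ch[of 1 m] by simp
      show "norm (char (\<nu> m) t - char (\<mu> m) (k m)) \<le> sqrt (2 * (1 - (1 - 1 / 4 ^ m) * \<phi> (1 / 2 ^ m)))"
        using \<mu>.norm_char_diff_le[OF \<mu>(2)[of m] w[of m], where t="real (k m)"] unfolding char\<nu> 1 Re_complex_of_real
        by (simp add: w_def)
    qed
    from tendsto_add[OF this lim] show ?thesis by simp
  qed
  \<comment> \<open>Negative times follow by conjugation, since the limit is real and even.\<close>
  have char_minus: "char (\<nu> m) (- t) = cnj (char (\<nu> m) t)" for m t
    unfolding char_def by (subst Bochner_Integration.integral_cnj[symmetric]) (simp add: exp_cnj)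
  have conv: "(\<lambda>m. char (\<nu> m) t) \<longlonglongrightarrow> \<phi> t" for t
  proof (cases "t \<ge> 0")
    case False
    have "(\<lambda>m. cnj (char (\<nu> m) (- t))) \<longlonglongrightarrow> cnj (complex_of_real (\<phi> (- t)))"
      using conv_nonneg[of "- t"] False by (intro tendsto_cnj) auto
    then show ?thesis using even[of t] by (simp add: char_minus[symmetric])
  qed (use conv_nonneg in auto)
  have "isCont (\<lambda>t. complex_of_real (\<phi> t)) 0" by (intro continuous_intros cont)
  from Levy_continuity_exists[OF \<nu> conv this] that show thesis by metis
qed

section \<open>Gaussian processes and their covariances\<close>

text \<open>Writing every Gaussian law as an affine image of the standard one absorbs the point
  masses, so later arguments need no case distinction on \<open>\<sigma>\<close>.\<close>

lemma gaussian_law_eq_distr_std_normal: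
  assumes "\<sigma> \<ge> 0"
  shows "gaussian_law m \<sigma> = distr std_normal_distribution borel (\<lambda>x. m + \<sigma> * x)"
proof (cases "\<sigma> = 0")
  case True
  interpret Z: real_distribution std_normal_distribution by (rule real_dist_normal_dist)
  show ?thesis
    using Z.distr_const[of m borel] True by (simp add: gaussian_law_def)
next
  case False
  interpret Z: real_distribution std_normal_distribution by (rule real_dist_normal_dist)
  have "distributed std_normal_distribution lborel (\<lambda>x. x) std_normal_density"
    unfolding distributed_def by (auto simp: distr_id2)
  from Z.normal_density_affine[OF this, of \<sigma> m]
  have "distributed std_normal_distribution lborel (\<lambda>x. m + \<sigma> * x) (normal_density m \<sigma>)"
    using False assms by simp
  then have "distr std_normal_distribution lborel (\<lambda>x. m + \<sigma> * x) = density lborel (normal_density m \<sigma>)"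
    by (rule distributed_distr_eq_density)
  moreover have "distr std_normal_distribution lborel (\<lambda>x. m + \<sigma> * x) = distr std_normal_distribution borel (\<lambda>x. m + \<sigma> * x)"
    by (rule distr_cong) auto
  ultimately show ?thesis using False by (simp add: gaussian_law_def)
qed

text \<open>Centring forces \<open>m = 0\<close>, and then the second moment equals the square of
  \<open>\<sigma>\<close>, so it alone determines the law.\<close>

lemma (in prob_space) centered_gaussian_variable:
  assumes [measurable]: "X \<in> borel_measurable M"
    and law: "distr M borel X = gaussian_law m \<sigma>" "\<sigma> \<ge> 0" and mean: "expectation X = 0"
  shows "integrable M (\<lambda>x. (X x)\<^sup>2)" (is ?integrable)
    and "distr M borel X = distr std_normal_distribution borel (\<lambda>x. sqrt (expectation (\<lambda>x. (X x)\<^sup>2)) * x)" (is ?distr)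
proof -
  let ?N = std_normal_distribution
  interpret Z: real_distribution ?N by (rule real_dist_normal_dist)
  have eq: "distr M borel X = distr ?N borel (\<lambda>x. m + \<sigma> * x)"
    using law gaussian_law_eq_distr_std_normal by simp
  have N1: "integrable ?N (\<lambda>x. x)" "(LINT x|?N. x) = 0"
    and N2: "integrable ?N (\<lambda>x. x\<^sup>2)" "(LINT x|?N. x\<^sup>2) = 1"
    using integrable_std_normal_distribution_moment[of 1] integrable_std_normal_distribution_moment[of 2]
      integral_std_normal_distribution_moment_odd[of 1] std_normal_distribution_even_moments(1)[of 1] by auto
  have "expectation X = (LINT x|distr M borel X. x)" by (simp add: integral_distr)
  also have "\<dots> = (LINT x|?N. m + \<sigma> * x)" unfolding eq by (subst integral_distr) auto
  also have "\<dots> = m" using N1 Z.prob_space by simp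
  finally have m: "m = 0" using mean by simp
  have eq0: "distr M borel X = distr ?N borel (\<lambda>x. \<sigma> * x)" using eq m by simp
  have "integrable (distr M borel X) (\<lambda>x. x\<^sup>2)"
    unfolding eq0 using N2 by (subst integrable_distr_eq) (auto simp: power_mult_distrib)
  then show ?integrable by (subst (asm) integrable_distr_eq) auto
  have "expectation (\<lambda>x. (X x)\<^sup>2) = (LINT x|distr M borel X. x\<^sup>2)" by (simp add: integral_distr)
  also have "\<dots> = \<sigma>\<^sup>2" unfolding eq0 using N2 by (subst integral_distr) (auto simp: power_mult_distrib)
  finally show ?distr using eq0 law(2) by simp
qed

lemma (in prob_space) gaussian_process_combination:
  fixes a :: "'i \<Rightarrow> real"
  assumes G: "gaussian_process M T X" and c: "centered_process M T X"
    and J: "finite J" "J \<subseteq> T"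
  defines "L \<equiv> \<lambda>\<omega>. \<Sum>t\<in>J. a t * X t \<omega>"
  shows "L \<in> borel_measurable M" and "integrable M (\<lambda>x. (L x)\<^sup>2)"
    and "distr M borel L = distr std_normal_distribution borel (\<lambda>x. sqrt (expectation (\<lambda>x. (L x)\<^sup>2)) * x)"
proof -
  have [measurable]: "X t \<in> borel_measurable M" if "t \<in> J" for t
    using G that J by (auto simp: gaussian_process_def)
  show L[measurable]: "L \<in> borel_measurable M" unfolding L_def by measurable
  have "integrable M (X t)" "expectation (X t) = 0" if "t \<in> J" for t
    using c that J by (auto simp: centered_process_def)
  then have mean: "expectation L = 0" unfolding L_def by simp
  obtain m \<sigma> where "\<sigma> \<ge> 0" "distr M borel L = gaussian_law m \<sigma>"
    using G J unfolding gaussian_process_def L_def by blast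
  from centered_gaussian_variable[OF L this(2,1) mean]
  show "integrable M (\<lambda>x. (L x)\<^sup>2)"
    and "distr M borel L = distr std_normal_distribution borel (\<lambda>x. sqrt (expectation (\<lambda>x. (L x)\<^sup>2)) * x)" .
qed

lemma integrable_mult_of_squares:
  fixes f g :: "'a \<Rightarrow> real"
  assumes [measurable]: "f \<in> borel_measurable M" "g \<in> borel_measurable M"
    and "integrable M (\<lambda>x. (f x)\<^sup>2)" "integrable M (\<lambda>x. (g x)\<^sup>2)"
  shows "integrable M (\<lambda>x. f x * g x)"
proof (rule Bochner_Integration.integrable_bound[where f="\<lambda>x. (f x)\<^sup>2 + (g x)\<^sup>2"])
  show "AE x in M. norm (f x * g x) \<le> norm ((f x)\<^sup>2 + (g x)\<^sup>2)"
  proof (rule AE_I2)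
    fix x
    have "2 * (\<bar>f x\<bar> * \<bar>g x\<bar>) \<le> (f x)\<^sup>2 + (g x)\<^sup>2"
      using sum_squares_bound[of "\<bar>f x\<bar>" "\<bar>g x\<bar>"] by simp
    moreover have "0 \<le> \<bar>f x\<bar> * \<bar>g x\<bar>" by simp
    ultimately show "norm (f x * g x) \<le> norm ((f x)\<^sup>2 + (g x)\<^sup>2)"
      unfolding real_norm_def abs_mult by linarith
  qed
qed (use assms in auto)

lemma integral_Cauchy_Schwarz:
  fixes f g :: "'a \<Rightarrow> real"
  assumes [measurable]: "f \<in> borel_measurable M" "g \<in> borel_measurable M"
    and f2: "integrable M (\<lambda>x. (f x)\<^sup>2)" and g2: "integrable M (\<lambda>x. (g x)\<^sup>2)"
  shows "\<bar>LINT x|M. f x * g x\<bar> \<le> sqrt (LINT x|M. (f x)\<^sup>2) * sqrt (LINT x|M. (g x)\<^sup>2)"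
proof -
  define A B C where "A = (LINT x|M. (f x)\<^sup>2)" and "B = (LINT x|M. (g x)\<^sup>2)" and "C = (LINT x|M. f x * g x)"
  have fg: "integrable M (\<lambda>x. f x * g x)" by (rule integrable_mult_of_squares) (use assms in auto)
  have B0: "B \<ge> 0" unfolding B_def by simp
  have "C\<^sup>2 \<le> A * B"
  proof (cases "B = 0")
    case True
    then have "AE x in M. g x = 0"
      using integral_nonneg_eq_0_iff_AE[OF g2] unfolding B_def by simp
    then have "C = (LINT x|M. 0)" unfolding C_def by (intro integral_cong_AE) auto
    then show ?thesis using True by simp
  next
    case False
    \<comment> \<open>This is the squared residual of projecting \<open>f\<close> onto
      \<open>g\<close>, multiplied through by \<open>B\<close> to avoid a division.\<close>
    have "0 \<le> (LINT x|M. (B * f x - C * g x)\<^sup>2)" by simp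
    also have "\<dots> = (LINT x|M. B\<^sup>2 * (f x)\<^sup>2 - (2 * B * C) * (f x * g x) + C\<^sup>2 * (g x)\<^sup>2)"
      by (rule Bochner_Integration.integral_cong) (auto simp: power2_eq_square algebra_simps)
    also have "\<dots> = B\<^sup>2 * A - (2 * B * C) * C + C\<^sup>2 * B"
      using f2 g2 fg unfolding A_def B_def C_def by simp
    also have "\<dots> = B * (A * B - C\<^sup>2)" by (simp add: power2_eq_square algebra_simps)
    finally show ?thesis using B0 False by (simp add: zero_le_mult_iff)
  qed
  then have "sqrt (C\<^sup>2) \<le> sqrt (A * B)" by (rule real_sqrt_le_mono)
  then show ?thesis by (simp add: A_def B_def C_def real_sqrt_mult)
qed

lemma covariance_sym: "covariance M X s t = covariance M X t s"
  by (simp add: covariance_def mult.commute)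

lemma (in prob_space) gaussian_process_square_integrable:
  assumes "gaussian_process M T X" "centered_process M T X" "t \<in> T"
  shows "integrable M (\<lambda>x. (X t x)\<^sup>2)"
  using gaussian_process_combination(2)[OF assms(1,2), of "{t}" "\<lambda>_. 1"] assms(3) by simp

lemma (in prob_space) gaussian_process_mult_integrable:
  assumes "gaussian_process M T X" "centered_process M T X" "s \<in> T" "t \<in> T"
  shows "integrable M (\<lambda>x. X s x * X t x)"
  using assms gaussian_process_square_integrable[OF assms(1,2)]
  by (intro integrable_mult_of_squares) (auto simp: gaussian_process_def)

lemma integral_combination_square:
  assumes "\<And>s t. s \<in> J \<Longrightarrow> t \<in> J \<Longrightarrow> integrable M (\<lambda>\<omega>. X s \<omega> * X t \<omega>)"
  shows "(LINT \<omega>|M. (\<Sum>t\<in>J. a t * X t \<omega>)\<^sup>2) = (\<Sum>s\<in>J. \<Sum>t\<in>J. a s * a t * covariance M X s t)"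
proof -
  have "(\<Sum>t\<in>J. a t * X t \<omega>)\<^sup>2 = (\<Sum>s\<in>J. \<Sum>t\<in>J. (a s * a t) * (X s \<omega> * X t \<omega>))" for \<omega>
    by (simp add: power2_eq_square sum_product mult_ac)
  then show ?thesis using assms by (simp add: covariance_def)
qed

text \<open>Stated through characteristic functions so that it passes to sums of independent copies by
  multiplication, without proving that these sums are Gaussian.\<close>

definition gaussian_char :: "'a measure \<Rightarrow> 'i set \<Rightarrow> ('i \<Rightarrow> 'a \<Rightarrow> real) \<Rightarrow> ('i \<Rightarrow> 'i \<Rightarrow> real) \<Rightarrow> bool" where
  "gaussian_char M T X c \<longleftrightarrow>
     (\<forall>t\<in>T. X t \<in> borel_measurable M) \<and> (\<forall>s\<in>T. \<forall>t\<in>T. c s t = c t s) \<and>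
     (\<forall>J a. finite J \<and> J \<subseteq> T \<longrightarrow> (CLINT \<omega>|M. iexp (\<Sum>t\<in>J. a t * X t \<omega>)) =
        complex_of_real (exp (- (\<Sum>s\<in>J. \<Sum>t\<in>J. a s * a t * c s t) / 2)))"

lemma gaussian_charD:
  assumes "gaussian_char M T X c"
  shows "t \<in> T \<Longrightarrow> X t \<in> borel_measurable M"
    and "s \<in> T \<Longrightarrow> t \<in> T \<Longrightarrow> c s t = c t s"
    and "finite J \<Longrightarrow> J \<subseteq> T \<Longrightarrow> (CLINT \<omega>|M. iexp (\<Sum>t\<in>J. a t * X t \<omega>)) =
        complex_of_real (exp (- (\<Sum>s\<in>J. \<Sum>t\<in>J. a s * a t * c s t) / 2))"
  using assms unfolding gaussian_char_def by auto

text \<open>A combination has the law of \<open>sqrt ?Q\<close> times a standard normal variable.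
  Frequency 1 is enough because the coefficients \<open>a\<close> are arbitrary.\<close>

lemma (in prob_space) gaussian_char_covariance:
  assumes "gaussian_process M T X" "centered_process M T X"
  shows "gaussian_char M T X (covariance M X)"
  unfolding gaussian_char_def
proof (intro conjI allI impI ballI)
  fix J a assume J: "finite J \<and> J \<subseteq> T"
  let ?L = "\<lambda>\<omega>. \<Sum>t\<in>J. a t * X t \<omega>" and ?Q = "\<Sum>s\<in>J. \<Sum>t\<in>J. a s * a t * covariance M X s t"
  have Q: "expectation (\<lambda>\<omega>. (?L \<omega>)\<^sup>2) = ?Q"
    using J by (intro integral_combination_square gaussian_process_mult_integrable[OF assms]) auto
  have "0 \<le> expectation (\<lambda>\<omega>. (?L \<omega>)\<^sup>2)" by simp
  then have Q0: "?Q \<ge> 0" unfolding Q .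
  have L[measurable]: "?L \<in> borel_measurable M"
    and distr: "distr M borel ?L = distr std_normal_distribution borel (\<lambda>x. sqrt ?Q * x)"
    using gaussian_process_combination(1,3)[OF assms, of J a] J unfolding Q by blast+
  have "(CLINT \<omega>|M. iexp (?L \<omega>)) = (CLINT x|distr M borel ?L. iexp x)"
    by (rule integral_distr[symmetric, OF L]) simp
  also have "\<dots> = char std_normal_distribution (sqrt ?Q)"
    unfolding distr char_def by (rule integral_distr) auto
  also have "\<dots> = complex_of_real (exp (- ?Q / 2))"
    using Q0 by (simp add: char_std_normal_distribution)
  finally show "(CLINT \<omega>|M. iexp (?L \<omega>)) = complex_of_real (exp (- ?Q / 2))" .
qed (use assms in \<open>auto simp: gaussian_process_def covariance_sym\<close>)

text \<open>Serves time dilation (\<open>w\<close> constantly 1), multiplication by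
  \<open>sqrt \<alpha>\<close> (\<open>f\<close> the identity) and the shifted transformed process
  (\<open>f y = exp (y + h)\<close>). Injectivity of \<open>f\<close> lets each time in the image
  carry a single coefficient, transported by the inverse \<open>g\<close>.\<close>

lemma gaussian_char_reindex:
  assumes X: "gaussian_char M T X c" and inj: "inj_on f S" and im: "f ` S \<subseteq> T"
  shows "gaussian_char M S (\<lambda>s \<omega>. w s * X (f s) \<omega>) (\<lambda>s t. w s * w t * c (f s) (f t))"
  unfolding gaussian_char_def
proof (intro conjI allI impI ballI)
  fix J a assume J: "finite J \<and> J \<subseteq> S"
  define g where "g = the_inv_into S f"
  have gf: "g (f s) = s" if "s \<in> J" for s
    unfolding g_def using that J by (intro the_inv_into_f_f[OF inj]) auto
  have injJ: "inj_on f J" using J by (auto intro: inj_on_subset[OF inj])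
  let ?b = "\<lambda>t. a (g t) * w (g t)"
  have "finite (f ` J) \<and> f ` J \<subseteq> T" using J im by auto
  then have "(CLINT \<omega>|M. iexp (\<Sum>t\<in>f ` J. ?b t * X t \<omega>)) =
      complex_of_real (exp (- (\<Sum>s\<in>f ` J. \<Sum>t\<in>f ` J. ?b s * ?b t * c s t) / 2))"
    using gaussian_charD(3)[OF X, of "f ` J" ?b] by simp
  moreover have "(\<Sum>t\<in>f ` J. ?b t * X t \<omega>) = (\<Sum>t\<in>J. a t * (w t * X (f t) \<omega>))" for \<omega>
    unfolding sum.reindex[OF injJ] comp_def by (intro sum.cong refl) (simp add: gf)
  moreover have "(\<Sum>s\<in>f ` J. \<Sum>t\<in>f ` J. ?b s * ?b t * c s t) =
      (\<Sum>s\<in>J. \<Sum>t\<in>J. a s * a t * (w s * w t * c (f s) (f t)))"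
    unfolding sum.reindex[OF injJ] comp_def by (intro sum.cong refl) (simp add: gf)
  ultimately show "(CLINT \<omega>|M. iexp (\<Sum>t\<in>J. a t * (w t * X (f t) \<omega>))) =
      complex_of_real (exp (- (\<Sum>s\<in>J. \<Sum>t\<in>J. a s * a t * (w s * w t * c (f s) (f t))) / 2))" by (simp only:)
next
  fix s t assume "s \<in> S" "t \<in> S"
  then have "c (f s) (f t) = c (f t) (f s)" using X im unfolding gaussian_char_def by blast
  then show "w s * w t * c (f s) (f t) = w t * w s * c (f t) (f s)" by simp
next
  fix s assume "s \<in> S"
  then have "X (f s) \<in> borel_measurable M" using X im unfolding gaussian_char_def by blast
  then show "(\<lambda>\<omega>. w s * X (f s) \<omega>) \<in> borel_measurable M" by simp
qed

text \<open>The exponential of the sum factors over the coordinates of the product space, so the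
  characteristic function is an n-th power and the quadratic form is multiplied by
  \<open>n\<close>.\<close>

lemma gaussian_char_sum_copies:
  assumes M: "prob_space M" and X: "gaussian_char M T X c"
  shows "gaussian_char (copies_space n M) T (\<lambda>t \<omega>. \<Sum>i<n. indep_copy X i t \<omega>) (\<lambda>s t. real n * c s t)"
  unfolding gaussian_char_def
proof (intro conjI allI impI ballI)
  have meas: "X t \<in> borel_measurable M" if "t \<in> T" for t
    using X that unfolding gaussian_char_def by blast
  have proj: "(\<lambda>\<omega>. \<omega> i) \<in> measurable (copies_space n M) M" if "i < n" for i
    unfolding copies_space_def using that by (intro measurable_component_singleton) auto
  show "(\<lambda>\<omega>. \<Sum>i<n. indep_copy X i t \<omega>) \<in> borel_measurable (copies_space n M)" if "t \<in> T" for t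
    unfolding indep_copy_def
  proof (rule borel_measurable_sum)
    show "(\<lambda>\<omega>. X t (\<omega> i)) \<in> borel_measurable (copies_space n M)" if "i \<in> {..<n}" for i
      using that measurable_compose[OF proj[of i] meas[OF \<open>t \<in> T\<close>]] by simp
  qed
  fix J a assume J: "finite J \<and> J \<subseteq> T"
  interpret M: prob_space M by fact
  interpret P: product_sigma_finite "\<lambda>_::nat. M" ..
  let ?L = "\<lambda>x. \<Sum>t\<in>J. a t * X t x" and ?Q = "\<Sum>s\<in>J. \<Sum>t\<in>J. a s * a t * c s t"
  have [measurable]: "X t \<in> borel_measurable M" if "t \<in> J" for t using that J meas by auto
  have int: "complex_integrable M (\<lambda>x. iexp (?L x))"
    by (rule M.integrable_const_bound[where B=1]) (auto simp del: of_real_sum of_real_mult)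
  have "(\<Sum>t\<in>J. a t * (\<Sum>i<n. indep_copy X i t \<omega>)) = (\<Sum>i<n. ?L (\<omega> i))" for \<omega>
    unfolding indep_copy_def sum_distrib_left by (rule sum.swap)
  then have "(CLINT \<omega>|copies_space n M. iexp (\<Sum>t\<in>J. a t * (\<Sum>i<n. indep_copy X i t \<omega>))) =
      (CLINT \<omega>|copies_space n M. \<Prod>i<n. iexp (?L (\<omega> i)))"
    by (simp only: of_real_sum sum_distrib_left exp_sum finite_lessThan)
  also have "\<dots> = (\<Prod>i<n. CLINT x|M. iexp (?L x))"
    unfolding copies_space_def by (rule P.product_integral_prod) (use int in auto)
  also have "(CLINT x|M. iexp (?L x)) = complex_of_real (exp (- ?Q / 2))"
    using X J unfolding gaussian_char_def by blast
  also have "(\<Prod>i<n. complex_of_real (exp (- ?Q / 2))) = complex_of_real (exp (real n * (- ?Q / 2)))"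
    by (simp only: prod_constant card_lessThan exp_of_nat_mult of_real_power)
  also have "real n * (- ?Q / 2) = - (\<Sum>s\<in>J. \<Sum>t\<in>J. a s * a t * (real n * c s t)) / 2"
    by (simp add: sum_distrib_left mult.left_commute)
  finally show "(CLINT \<omega>|copies_space n M. iexp (\<Sum>t\<in>J. a t * (\<Sum>i<n. indep_copy X i t \<omega>))) =
      complex_of_real (exp (- (\<Sum>s\<in>J. \<Sum>t\<in>J. a s * a t * (real n * c s t)) / 2))" .
next
  fix s t assume "s \<in> T" "t \<in> T"
  then have "c s t = c t s" using X unfolding gaussian_char_def by blast
  then show "real n * c s t = real n * c t s" by simp
qed

lemma eq_in_law_char_eq:
  assumes law: "eq_in_law T M X N Y" and J: "finite J" "J \<subseteq> T"
    and X: "\<And>t. t \<in> T \<Longrightarrow> X t \<in> borel_measurable M" and Y: "\<And>t. t \<in> T \<Longrightarrow> Y t \<in> borel_measurable N"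
  shows "(CLINT \<omega>|M. iexp (\<Sum>t\<in>J. a t * X t \<omega>)) = (CLINT \<omega>|N. iexp (\<Sum>t\<in>J. a t * Y t \<omega>))"
proof -
  let ?h = "\<lambda>z. iexp (\<Sum>t\<in>J. a t * z t)"
  have h: "?h \<in> borel_measurable (\<Pi>\<^sub>M t\<in>J. borel)" by measurable
  have mX: "(\<lambda>\<omega>. \<lambda>t\<in>J. X t \<omega>) \<in> measurable M (\<Pi>\<^sub>M t\<in>J. borel)"
    using J X by (intro measurable_restrict) auto
  have mY: "(\<lambda>\<omega>. \<lambda>t\<in>J. Y t \<omega>) \<in> measurable N (\<Pi>\<^sub>M t\<in>J. borel)"
    using J Y by (intro measurable_restrict) auto
  have "(CLINT \<omega>|M. iexp (\<Sum>t\<in>J. a t * X t \<omega>)) = (CLINT \<omega>|M. ?h (\<lambda>t\<in>J. X t \<omega>))"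
    by simp
  also have "\<dots> = (CLINT z|distr M (\<Pi>\<^sub>M t\<in>J. borel) (\<lambda>\<omega>. \<lambda>t\<in>J. X t \<omega>). ?h z)"
    by (rule integral_distr[OF mX h, symmetric])
  also have "\<dots> = (CLINT z|distr N (\<Pi>\<^sub>M t\<in>J. borel) (\<lambda>\<omega>. \<lambda>t\<in>J. Y t \<omega>). ?h z)"
    using law J by (simp add: eq_in_law_def)
  also have "\<dots> = (CLINT \<omega>|N. ?h (\<lambda>t\<in>J. Y t \<omega>))"
    by (rule integral_distr[OF mY h])
  finally show ?thesis by simp
qed

text \<open>Equality of covariances gives equality of all characteristic functions of combinations,
  hence of laws. Conversely the quadratic forms agree, and polarisation recovers the
  kernels.\<close>

lemma eq_in_law_iff_of_gaussian_char:
  assumes M: "prob_space M" and N: "prob_space N"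
    and X: "gaussian_char M T X c" and Y: "gaussian_char N T Y d"
  shows "eq_in_law T M X N Y \<longleftrightarrow> (\<forall>s\<in>T. \<forall>t\<in>T. c s t = d s t)"
proof
  have mX: "X t \<in> borel_measurable M" and mY: "Y t \<in> borel_measurable N" if "t \<in> T" for t
    using gaussian_charD(1)[OF X that] gaussian_charD(1)[OF Y that] .
  {
    assume law: "eq_in_law T M X N Y"
    \<comment> \<open>Coefficients equal to 1 suffice: one-point sets give the diagonal, and
      two-point sets with symmetry give the other entries.\<close>
    have Q: "(\<Sum>s\<in>J. \<Sum>t\<in>J. c s t) = (\<Sum>s\<in>J. \<Sum>t\<in>J. d s t)" if J: "finite J" "J \<subseteq> T" for J
    proof -
      have "(CLINT \<omega>|M. iexp (\<Sum>t\<in>J. 1 * X t \<omega>)) =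
          complex_of_real (exp (- (\<Sum>s\<in>J. \<Sum>t\<in>J. 1 * 1 * c s t) / 2))"
        by (rule gaussian_charD(3)[OF X J])
      moreover have "(CLINT \<omega>|N. iexp (\<Sum>t\<in>J. 1 * Y t \<omega>)) =
          complex_of_real (exp (- (\<Sum>s\<in>J. \<Sum>t\<in>J. 1 * 1 * d s t) / 2))"
        by (rule gaussian_charD(3)[OF Y J])
      ultimately have "exp (- (\<Sum>s\<in>J. \<Sum>t\<in>J. c s t) / 2) = exp (- (\<Sum>s\<in>J. \<Sum>t\<in>J. d s t) / 2)"
        using eq_in_law_char_eq[where a="\<lambda>_. 1", OF law J mX mY]
        by (simp only: of_real_eq_iff mult_1 simp_thms)
      then show ?thesis by simp
    qed
    show "\<forall>s\<in>T. \<forall>t\<in>T. c s t = d s t"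
    proof (intro ballI)
      fix s t assume st: "s \<in> T" "t \<in> T"
      have diag: "c r r = d r r" if "r \<in> T" for r using Q[of "{r}"] that by simp
      show "c s t = d s t"
      proof (cases "s = t")
        case False
        have "c t s = c s t" "d t s = d s t"
          using gaussian_charD(2)[OF X] gaussian_charD(2)[OF Y] st by auto
        moreover have "c s s = d s s" "c t t = d t t" using diag st by auto
        moreover have "c s s + c s t + (c t s + c t t) = d s s + d s t + (d t s + d t t)"
          using Q[of "{s, t}"] False st by simp
        ultimately show ?thesis by simp
      qed (use diag st in simp)
    qed
  next
    assume eq: "\<forall>s\<in>T. \<forall>t\<in>T. c s t = d s t"
    show "eq_in_law T M X N Y"
      unfolding eq_in_law_def
    proof (intro allI impI Cramer_Wold)
      fix J a assume J: "finite J \<and> J \<subseteq> T"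
      have "(\<Sum>s\<in>J. \<Sum>t\<in>J. a s * a t * c s t) = (\<Sum>s\<in>J. \<Sum>t\<in>J. a s * a t * d s t)"
        using J eq by (intro sum.cong refl) (simp add: subset_iff)
      moreover have "(CLINT \<omega>|M. iexp (\<Sum>t\<in>J. a t * X t \<omega>)) =
          complex_of_real (exp (- (\<Sum>s\<in>J. \<Sum>t\<in>J. a s * a t * c s t) / 2))"
        using J by (intro gaussian_charD(3)[OF X]) auto
      moreover have "(CLINT \<omega>|N. iexp (\<Sum>t\<in>J. a t * Y t \<omega>)) =
          complex_of_real (exp (- (\<Sum>s\<in>J. \<Sum>t\<in>J. a s * a t * d s t) / 2))"
        using J by (intro gaussian_charD(3)[OF Y]) auto
      ultimately show "(CLINT \<omega>|M. iexp (\<Sum>t\<in>J. a t * X t \<omega>)) = (CLINT \<omega>|N. iexp (\<Sum>t\<in>J. a t * Y t \<omega>))"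
        by simp
    qed (use prob_space.finite_measure[OF M] prob_space.finite_measure[OF N] mX mY in auto)
  }
qed

section \<open>Continuity in probability\<close>

text \<open>Without mass outside [-1, 1] the fourth moment would be at most 1, yet it is 3. The
  second moment equals 1 and would not contradict the bound.\<close>

lemma std_normal_tail_pos: "0 < measure std_normal_distribution {x. 1 < \<bar>x\<bar>}"
proof (rule ccontr)
  let ?N = std_normal_distribution
  interpret Z: real_distribution ?N by (rule real_dist_normal_dist)
  assume "\<not> 0 < measure ?N {x. 1 < \<bar>x\<bar>}"
  then have "measure ?N {x. 1 < \<bar>x\<bar>} = 0" by (simp add: zero_less_measure_iff)
  then have "emeasure ?N {x. 1 < \<bar>x\<bar>} = 0" by (simp add: Z.emeasure_eq_measure)
  then have "AE x in ?N. \<not> 1 < \<bar>x\<bar>" by (intro AE_I[of _ _ "{x. 1 < \<bar>x\<bar>}"]) auto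
  then have "AE x in ?N. x ^ 4 \<le> 1"
  proof eventually_elim
    case (elim x)
    then have "\<bar>x\<bar> ^ 4 \<le> 1 ^ 4" by (intro power_mono) auto
    then show ?case by simp
  qed
  then have "(LINT x|?N. x ^ 4) \<le> (LINT x|?N. 1)"
    using integrable_std_normal_distribution_moment[of 4] by (intro integral_mono_AE) auto
  moreover have "(LINT x|?N. x ^ 4) = 3"
    using std_normal_distribution_even_moments(1)[of 2] by (simp add: fact_numeral)
  ultimately show False using Z.prob_space by simp
qed

text \<open>A Gaussian variable that is small in probability is small in mean square, since all centered
  Gaussian laws are dilations of the standard one.\<close>

lemma (in prob_space) gaussian_tail_ge:
  assumes [measurable]: "L \<in> borel_measurable M"
    and law: "distr M borel L = distr std_normal_distribution borel (\<lambda>x. \<sigma> * x)"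
    and \<epsilon>: "0 < \<epsilon>" "\<epsilon> \<le> \<sigma>"
  shows "measure std_normal_distribution {x. 1 < \<bar>x\<bar>} \<le> prob {x \<in> space M. \<epsilon> < \<bar>L x\<bar>}"
proof -
  let ?N = std_normal_distribution
  interpret Z: real_distribution ?N by (rule real_dist_normal_dist)
  have "prob {x \<in> space M. \<epsilon> < \<bar>L x\<bar>} = measure (distr M borel L) {x. \<epsilon> < \<bar>x\<bar>}"
    by (subst measure_distr) (auto intro!: arg_cong[where f=prob])
  also have "\<dots> = measure ?N {x. \<epsilon> < \<bar>\<sigma> * x\<bar>}"
    unfolding law by (subst measure_distr) (auto intro!: arg_cong[where f="measure ?N"])
  also have "\<dots> \<ge> measure ?N {x. 1 < \<bar>x\<bar>}"
  proof (rule Z.finite_measure_mono)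
    show "{x. 1 < \<bar>x\<bar>} \<subseteq> {x. \<epsilon> < \<bar>\<sigma> * x\<bar>}"
    proof safe
      fix x :: real assume "1 < \<bar>x\<bar>"
      then have "\<sigma> * 1 < \<sigma> * \<bar>x\<bar>" using \<epsilon> by (intro mult_strict_left_mono) auto
      moreover have "\<bar>\<sigma> * x\<bar> = \<sigma> * \<bar>x\<bar>" using \<epsilon> by (simp add: abs_mult)
      ultimately show "\<epsilon> < \<bar>\<sigma> * x\<bar>" using \<epsilon>(2) by linarith
    qed
  qed simp
  finally show ?thesis .
qed

lemma (in prob_space) gaussian_process_increment:
  assumes G: "gaussian_process M T X" and c: "centered_process M T X" and st: "s \<in> T" "t \<in> T"
  shows "integrable M (\<lambda>\<omega>. (X s \<omega> - X t \<omega>)\<^sup>2)"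
    and "distr M borel (\<lambda>\<omega>. X s \<omega> - X t \<omega>) =
      distr std_normal_distribution borel (\<lambda>x. sqrt (expectation (\<lambda>\<omega>. (X s \<omega> - X t \<omega>)\<^sup>2)) * x)"
    and "expectation (\<lambda>\<omega>. (X s \<omega> - X t \<omega>)\<^sup>2) =
      covariance M X s s - 2 * covariance M X s t + covariance M X t t"
proof -
  \<comment> \<open>For \<open>s = t\<close> the set \<open>{s, t}\<close> collapses to one point
    with coefficient 1 and would give \<open>X s\<close> instead of 0; the empty sum is used
    there.\<close>
  define J where "J = (if s = t then {} else {s, t})"
  define a where "a r = (if r = s then 1 else - 1 :: real)" for r
  have L: "(\<Sum>r\<in>J. a r * X r \<omega>) = X s \<omega> - X t \<omega>" for \<omega>
    by (simp add: J_def a_def)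
  have J: "finite J" "J \<subseteq> T" using st by (auto simp: J_def)
  show "integrable M (\<lambda>\<omega>. (X s \<omega> - X t \<omega>)\<^sup>2)"
    using gaussian_process_combination(2)[OF G c J, of a] unfolding L .
  show "distr M borel (\<lambda>\<omega>. X s \<omega> - X t \<omega>) =
      distr std_normal_distribution borel (\<lambda>x. sqrt (expectation (\<lambda>\<omega>. (X s \<omega> - X t \<omega>)\<^sup>2)) * x)"
    using gaussian_process_combination(3)[OF G c J, of a] unfolding L .
  have "(X s \<omega> - X t \<omega>)\<^sup>2 = X s \<omega> * X s \<omega> - 2 * (X s \<omega> * X t \<omega>) + X t \<omega> * X t \<omega>" for \<omega>
    by (simp add: power2_eq_square algebra_simps)
  then show "expectation (\<lambda>\<omega>. (X s \<omega> - X t \<omega>)\<^sup>2) =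
      covariance M X s s - 2 * covariance M X s t + covariance M X t t"
    using gaussian_process_mult_integrable[OF G c] st by (simp add: covariance_def)
qed

text \<open>The number \<open>?p\<close> is a positive threshold independent of \<open>s\<close>: an
  increment with second moment at least \<open>e\<close> exceeds \<open>sqrt e\<close> in modulus
  with probability at least \<open>?p\<close>, which is impossible near \<open>t\<close>.\<close>

lemma (in prob_space) continuous_in_probability_imp_mean_square:
  fixes X :: "real \<Rightarrow> 'a \<Rightarrow> real"
  assumes G: "gaussian_process M T X" and c: "centered_process M T X"
    and cip: "continuous_in_probability M T X" and t: "t \<in> T"
  shows "((\<lambda>s. expectation (\<lambda>\<omega>. (X s \<omega> - X t \<omega>)\<^sup>2)) \<longlongrightarrow> 0) (at t within T)"
proof (rule tendstoI)
  fix e :: real assume e: "e > 0"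
  let ?p = "measure std_normal_distribution {x. 1 < \<bar>x\<bar>}"
  have "sqrt e > 0" using e by simp
  with cip t have "((\<lambda>s. prob {\<omega>\<in>space M. sqrt e < \<bar>X s \<omega> - X t \<omega>\<bar>}) \<longlongrightarrow> 0) (at t within T)"
    unfolding continuous_in_probability_def by blast
  then have "eventually (\<lambda>s. prob {\<omega>\<in>space M. sqrt e < \<bar>X s \<omega> - X t \<omega>\<bar>} < ?p) (at t within T)"
    by (rule order_tendstoD(2)[OF _ std_normal_tail_pos])
  moreover have "eventually (\<lambda>s. s \<in> T) (at t within T)"
    by (simp add: eventually_at_filter)
  ultimately show "eventually (\<lambda>s. dist (expectation (\<lambda>\<omega>. (X s \<omega> - X t \<omega>)\<^sup>2)) 0 < e) (at t within T)"
  proof eventually_elim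
    case (elim s)
    have "X s \<in> borel_measurable M" "X t \<in> borel_measurable M"
      using G elim(2) t unfolding gaussian_process_def by blast+
    then have "(\<lambda>\<omega>. X s \<omega> - X t \<omega>) \<in> borel_measurable M" by (rule borel_measurable_diff)
    then have tail: "?p \<le> prob {\<omega>\<in>space M. sqrt e < \<bar>X s \<omega> - X t \<omega>\<bar>}"
      if "sqrt e \<le> sqrt (expectation (\<lambda>\<omega>. (X s \<omega> - X t \<omega>)\<^sup>2))"
      using that e by (intro gaussian_tail_ge[OF _ gaussian_process_increment(2)[OF G c elim(2) t]]) simp_all
    have "\<not> sqrt e \<le> sqrt (expectation (\<lambda>\<omega>. (X s \<omega> - X t \<omega>)\<^sup>2))"
      using tail elim(1) by linarith
    moreover have "0 \<le> expectation (\<lambda>\<omega>. (X s \<omega> - X t \<omega>)\<^sup>2)" by simp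
    ultimately show ?case unfolding dist_real_def real_sqrt_le_iff by linarith
  qed
qed

lemma (in prob_space) mean_square_continuous_imp_covariance_continuous:
  fixes X :: "real \<Rightarrow> 'a \<Rightarrow> real"
  assumes G: "gaussian_process M T X" and c: "centered_process M T X"
    and ms: "\<And>t. t \<in> T \<Longrightarrow> ((\<lambda>s. expectation (\<lambda>\<omega>. (X s \<omega> - X t \<omega>)\<^sup>2)) \<longlongrightarrow> 0) (at t within T)"
  shows "continuous_on (T \<times> T) (\<lambda>(s, t). covariance M X s t)"
  unfolding continuous_on_sequentially
proof (intro allI ballI impI)
  fix x :: "nat \<Rightarrow> real \<times> real" and a :: "real \<times> real"
  assume a: "a \<in> T \<times> T" and x: "(\<forall>n. x n \<in> T \<times> T) \<and> x \<longlonglongrightarrow> a"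
  obtain s t where st: "a = (s, t)" "s \<in> T" "t \<in> T" using a by auto
  define u v where "u n = fst (x n)" and "v n = snd (x n)" for n
  have uv: "u n \<in> T" "v n \<in> T" for n using x unfolding u_def v_def by (auto simp: mem_Times_iff)
  have lim: "u \<longlonglongrightarrow> s" "v \<longlonglongrightarrow> t"
    using tendsto_fst[of x a sequentially] tendsto_snd[of x a sequentially] x
    unfolding u_def[abs_def] v_def[abs_def] st(1) by simp_all
  define d where "d p q = sqrt (expectation (\<lambda>\<omega>. (X p \<omega> - X q \<omega>)\<^sup>2))" for p q
  have d0: "(\<lambda>n. d (w n) r) \<longlonglongrightarrow> 0" if r: "r \<in> T" and w: "\<And>n. w n \<in> T" "w \<longlonglongrightarrow> r" for w r
  proof -
    \<comment> \<open>The limit in the hypothesis ignores the point \<open>r\<close> itself. The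
      function vanishes there, so it is continuous at \<open>r\<close>, and sequences that hit
      \<open>r\<close> are allowed.\<close>
    have "continuous (at r within T) (\<lambda>p. expectation (\<lambda>\<omega>. (X p \<omega> - X r \<omega>)\<^sup>2))"
      unfolding continuous_within using ms[OF r] by simp
    then have "(\<lambda>n. expectation (\<lambda>\<omega>. (X (w n) \<omega> - X r \<omega>)\<^sup>2)) \<longlonglongrightarrow> expectation (\<lambda>\<omega>. (X r \<omega> - X r \<omega>)\<^sup>2)"
      unfolding continuous_within_sequentially comp_def using w by (elim allE[of _ w]) auto
    then have "(\<lambda>n. expectation (\<lambda>\<omega>. (X (w n) \<omega> - X r \<omega>)\<^sup>2)) \<longlonglongrightarrow> 0" by simp
    from tendsto_real_sqrt[OF this] show ?thesis unfolding d_def by simp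
  qed
  note du = d0[OF st(2) uv(1) lim(1)] and dv = d0[OF st(3) uv(2) lim(2)]
  define A B where "A = sqrt (expectation (\<lambda>\<omega>. (X s \<omega>)\<^sup>2))" and "B = sqrt (expectation (\<lambda>\<omega>. (X t \<omega>)\<^sup>2))"
  note sq = gaussian_process_square_integrable[OF G c] and inc = gaussian_process_increment(1)[OF G c]
  have bound: "norm (covariance M X (u n) (v n) - covariance M X s t) \<le> d (u n) s * d (v n) t + d (u n) s * B + A * d (v n) t" for n
  proof -
    let ?U = "\<lambda>\<omega>. X (u n) \<omega> - X s \<omega>" and ?V = "\<lambda>\<omega>. X (v n) \<omega> - X t \<omega>"
    have mm: "X (u n) \<in> borel_measurable M" "X (v n) \<in> borel_measurable M" "X s \<in> borel_measurable M" "X t \<in> borel_measurable M"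
      using uv[of n] st G unfolding gaussian_process_def by blast+
    note [measurable] = mm
    have mU: "?U \<in> borel_measurable M" and mV: "?V \<in> borel_measurable M" by simp_all
    note U2 = inc[OF uv(1)[of n] st(2)] and V2 = inc[OF uv(2)[of n] st(3)]
      and s2 = sq[OF st(2)] and t2 = sq[OF st(3)]
    note i = integrable_mult_of_squares[OF mU mV U2 V2] integrable_mult_of_squares[OF mU mm(4) U2 t2]
      integrable_mult_of_squares[OF mm(3) mV s2 V2] integrable_mult_of_squares[OF mm(3) mm(4) s2 t2]
    \<comment> \<open>Expanding around \<open>X s\<close> and \<open>X t\<close> leaves products
      with at least one increment, each controlled by Cauchy-Schwarz.\<close>
    have "X (u n) \<omega> * X (v n) \<omega> = ?U \<omega> * ?V \<omega> + ?U \<omega> * X t \<omega> + X s \<omega> * ?V \<omega> + X s \<omega> * X t \<omega>" for \<omega>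
      by (simp add: algebra_simps)
    then have "covariance M X (u n) (v n) =
        expectation (\<lambda>\<omega>. ?U \<omega> * ?V \<omega> + ?U \<omega> * X t \<omega> + X s \<omega> * ?V \<omega> + X s \<omega> * X t \<omega>)"
      unfolding covariance_def by (simp only:)
    also have "\<dots> = expectation (\<lambda>\<omega>. ?U \<omega> * ?V \<omega>) + expectation (\<lambda>\<omega>. ?U \<omega> * X t \<omega>) +
        expectation (\<lambda>\<omega>. X s \<omega> * ?V \<omega>) + covariance M X s t"
      unfolding covariance_def using i
      by (simp only: Bochner_Integration.integral_add Bochner_Integration.integrable_add)
    finally have eq: "covariance M X (u n) (v n) - covariance M X s t = expectation (\<lambda>\<omega>. ?U \<omega> * ?V \<omega>) +
        expectation (\<lambda>\<omega>. ?U \<omega> * X t \<omega>) + expectation (\<lambda>\<omega>. X s \<omega> * ?V \<omega>)" by simp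
    have "\<bar>expectation (\<lambda>\<omega>. ?U \<omega> * ?V \<omega>)\<bar> \<le> d (u n) s * d (v n) t"
      unfolding d_def by (rule integral_Cauchy_Schwarz[OF mU mV U2 V2])
    moreover have "\<bar>expectation (\<lambda>\<omega>. ?U \<omega> * X t \<omega>)\<bar> \<le> d (u n) s * B"
      unfolding d_def B_def by (rule integral_Cauchy_Schwarz[OF mU mm(4) U2 t2])
    moreover have "\<bar>expectation (\<lambda>\<omega>. X s \<omega> * ?V \<omega>)\<bar> \<le> A * d (v n) t"
      unfolding d_def A_def by (rule integral_Cauchy_Schwarz[OF mm(3) mV s2 V2])
    ultimately show ?thesis unfolding eq real_norm_def by linarith
  qed
  have "(\<lambda>n. d (u n) s * d (v n) t + d (u n) s * B + A * d (v n) t) \<longlonglongrightarrow> 0 * 0 + 0 * B + A * 0"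
    by (intro tendsto_add tendsto_mult du dv tendsto_const)
  then have "(\<lambda>n. covariance M X (u n) (v n) - covariance M X s t) \<longlonglongrightarrow> 0"
    by (intro Lim_null_comparison[OF always_eventually[OF allI[OF bound]]]) simp
  then have "(\<lambda>n. covariance M X (u n) (v n)) \<longlonglongrightarrow> covariance M X s t"
    by (simp add: LIM_zero_iff)
  then show "((\<lambda>(s, t). covariance M X s t) \<circ> x) \<longlonglongrightarrow> (case a of (s, t) \<Rightarrow> covariance M X s t)"
    unfolding st(1) u_def v_def comp_def by (simp add: case_prod_beta)
qed

text \<open>Chebyshev's inequality, with the mean square of the increment written as the covariance
  expression \<open>?h\<close>, which is continuous and vanishes at \<open>t\<close>.\<close>

lemma (in prob_space) covariance_continuous_imp_continuous_in_probability:
  fixes X :: "real \<Rightarrow> 'a \<Rightarrow> real"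
  assumes G: "gaussian_process M T X" and c: "centered_process M T X"
    and cont: "continuous_on (T \<times> T) (\<lambda>(s, t). covariance M X s t)"
  shows "continuous_in_probability M T X"
  unfolding continuous_in_probability_def
proof (intro ballI allI impI)
  fix t \<epsilon> :: real assume t: "t \<in> T" and \<epsilon>: "\<epsilon> > 0"
  let ?h = "\<lambda>s. covariance M X s s - 2 * covariance M X s t + covariance M X t t"
  have "(\<lambda>s. (s, s)) ` T \<subseteq> T \<times> T" and "(\<lambda>s. (s, t)) ` T \<subseteq> T \<times> T"
    using t by auto
  then have "continuous_on T (\<lambda>s. covariance M X s s)" "continuous_on T (\<lambda>s. covariance M X s t)"
    using continuous_on_compose2[OF cont, of T "\<lambda>s. (s, s)"] continuous_on_compose2[OF cont, of T "\<lambda>s. (s, t)"]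
    by (simp_all add: continuous_on_Pair continuous_on_id continuous_on_const)
  then have "continuous_on T ?h"
    by (intro continuous_on_add continuous_on_diff continuous_on_mult continuous_on_const)
  then have "(?h \<longlongrightarrow> ?h t) (at t within T)"
    using t unfolding continuous_on_def by blast
  then have h: "(?h \<longlongrightarrow> 0) (at t within T)" by simp
  show "((\<lambda>s. prob {\<omega>\<in>space M. \<epsilon> < \<bar>X s \<omega> - X t \<omega>\<bar>}) \<longlongrightarrow> 0) (at t within T)"
  proof (rule Lim_null_comparison)
    show "((\<lambda>s. ?h s / \<epsilon>\<^sup>2) \<longlongrightarrow> 0) (at t within T)"
      using tendsto_divide[OF h tendsto_const[of "\<epsilon>\<^sup>2"]] \<epsilon> by simp
    have "eventually (\<lambda>s. s \<in> T) (at t within T)"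
      by (simp add: eventually_at_filter)
    then show "eventually (\<lambda>s. norm (prob {\<omega>\<in>space M. \<epsilon> < \<bar>X s \<omega> - X t \<omega>\<bar>}) \<le> ?h s / \<epsilon>\<^sup>2) (at t within T)"
    proof eventually_elim
      case (elim s)
      have [measurable]: "X s \<in> borel_measurable M" "X t \<in> borel_measurable M"
        using G elim t unfolding gaussian_process_def by blast+
      have "prob {\<omega>\<in>space M. \<epsilon> < \<bar>X s \<omega> - X t \<omega>\<bar>} \<le> prob {\<omega>\<in>space M. \<epsilon>\<^sup>2 \<le> (X s \<omega> - X t \<omega>)\<^sup>2}"
      proof (rule finite_measure_mono)
        show "{\<omega>\<in>space M. \<epsilon> < \<bar>X s \<omega> - X t \<omega>\<bar>} \<subseteq> {\<omega>\<in>space M. \<epsilon>\<^sup>2 \<le> (X s \<omega> - X t \<omega>)\<^sup>2}"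
          using \<epsilon> power_mono[of \<epsilon> "\<bar>X s \<omega> - X t \<omega>\<bar>" 2 for \<omega>] by auto
      qed simp
      also have "\<dots> \<le> expectation (\<lambda>\<omega>. (X s \<omega> - X t \<omega>)\<^sup>2) / \<epsilon>\<^sup>2"
        using \<epsilon> gaussian_process_increment(1)[OF G c elim t]
        by (intro integral_Markov_inequality_measure[where A="{}"]) auto
      finally show ?case
        unfolding gaussian_process_increment(3)[OF G c elim t] by simp
    qed
  qed
qed

theorem (in prob_space) continuous_in_probability_iff_covariance_continuous:
  fixes X :: "real \<Rightarrow> 'a \<Rightarrow> real"
  assumes "gaussian_process M T X" "centered_process M T X"
  shows "continuous_in_probability M T X \<longleftrightarrow> continuous_on (T \<times> T) (\<lambda>(s, t). covariance M X s t)"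
proof
  assume "continuous_in_probability M T X"
  then show "continuous_on (T \<times> T) (\<lambda>(s, t). covariance M X s t)"
    by (intro mean_square_continuous_imp_covariance_continuous[OF assms]
        continuous_in_probability_imp_mean_square[OF assms])
next
  assume "continuous_on (T \<times> T) (\<lambda>(s, t). covariance M X s t)"
  then show "continuous_in_probability M T X"
    by (rule covariance_continuous_imp_continuous_in_probability[OF assms])
qed

section \<open>Scaling covariances and stationarity\<close>

definition scaling_covariance :: "(real \<Rightarrow> real \<Rightarrow> real) \<Rightarrow> bool" where
  "scaling_covariance c \<longleftrightarrow> (\<forall>\<alpha>>0. \<forall>s\<ge>0. \<forall>t\<ge>0. c (\<alpha> * s) (\<alpha> * t) = \<alpha> * c s t)"

lemma continuous_on_kernel_sequentially:
  fixes c :: "real \<Rightarrow> real \<Rightarrow> real"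
  assumes "continuous_on (T \<times> T) (\<lambda>(s, t). c s t)"
    and "s \<in> T" "t \<in> T" "\<And>n. u n \<in> T" "\<And>n. v n \<in> T" "u \<longlonglongrightarrow> s" "v \<longlonglongrightarrow> t"
  shows "(\<lambda>n. c (u n) (v n)) \<longlonglongrightarrow> c s t"
proof -
  have "(\<lambda>n. case (u n, v n) of (s, t) \<Rightarrow> c s t) \<longlonglongrightarrow> (case (s, t) of (s, t) \<Rightarrow> c s t)"
    by (rule continuous_on_tendsto_compose[OF assms(1) tendsto_Pair[OF assms(6,7)]])
       (simp_all add: assms)
  then show ?thesis by simp
qed

text \<open>For the dyadic number q = p / 2^m, the factor 2^m applied at (q s, q t) and the factor p
  applied at (s, t) lead to the same point, which gives scaling by q; dyadic numbers then
  approximate \<open>\<alpha>\<close>.\<close>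

lemma scaling_covariance_of_nat_scaling:
  assumes cont: "continuous_on ({0..} \<times> {0..}) (\<lambda>(s, t). c s t)"
    and nat: "\<And>(n::nat) s t. n \<ge> 1 \<Longrightarrow> s \<ge> 0 \<Longrightarrow> t \<ge> 0 \<Longrightarrow> c (real n * s) (real n * t) = real n * c s t"
  shows "scaling_covariance c"
  unfolding scaling_covariance_def
proof (intro allI impI)
  fix \<alpha> s t :: real assume \<alpha>: "\<alpha> > 0" and s: "s \<ge> 0" and t: "t \<ge> 0"
  define q where "q m = real (nat \<lfloor>\<alpha> * 2 ^ m\<rfloor>) / 2 ^ m" for m :: nat
  have q: "q \<longlonglongrightarrow> \<alpha>" unfolding q_def[abs_def] using \<alpha> by (intro tendsto_dyadic_floor) simp
  have q0: "q m \<ge> 0" for m by (simp add: q_def)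
  \<comment> \<open>Needed when \<open>\<alpha> * 2 ^ m < 1\<close>: then q is 0, a factor that
    \<open>nat\<close> does not cover.\<close>
  have c0: "c 0 0 = 0" using nat[of 2 0 0] by simp
  have rat: "c (q m * s) (q m * t) = q m * c s t" for m
  proof -
    define p where "p = nat \<lfloor>\<alpha> * 2 ^ m\<rfloor>"
    have qp: "q m = real p / 2 ^ m" by (simp add: q_def p_def)
    show ?thesis
    proof (cases "p = 0")
      case True
      then show ?thesis by (simp add: qp c0)
    next
      case False
      have "2 ^ m * c (q m * s) (q m * t) = c (2 ^ m * (q m * s)) (2 ^ m * (q m * t))"
        using nat[of "2 ^ m" "q m * s" "q m * t"] q0[of m] s t by simp
      also have "\<dots> = c (real p * s) (real p * t)" by (simp add: qp)
      also have "\<dots> = real p * c s t" using nat[of p s t] False s t by simp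
      finally show ?thesis by (simp add: qp field_simps)
    qed
  qed
  have "(\<lambda>m. c (q m * s) (q m * t)) \<longlonglongrightarrow> c (\<alpha> * s) (\<alpha> * t)"
  proof (rule continuous_on_kernel_sequentially[OF cont])
    show "(\<lambda>m. q m * s) \<longlonglongrightarrow> \<alpha> * s" "(\<lambda>m. q m * t) \<longlonglongrightarrow> \<alpha> * t"
      by (intro tendsto_mult q tendsto_const)+
  qed (use q0 \<alpha> s t in simp_all)
  moreover have "(\<lambda>m. c (q m * s) (q m * t)) \<longlonglongrightarrow> \<alpha> * c s t"
    unfolding rat by (intro tendsto_mult q tendsto_const)
  ultimately show "c (\<alpha> * s) (\<alpha> * t) = \<alpha> * c s t" by (rule LIMSEQ_unique)
qed

text \<open>Shifting both times by 1 / (n + 1) moves them into the open quadrant, and continuity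
  returns to the boundary.\<close>

lemma scaling_covariance_of_pos:
  assumes cont: "continuous_on ({0..} \<times> {0..}) (\<lambda>(s, t). c s t)"
    and pos: "\<And>\<alpha> s t. \<alpha> > 0 \<Longrightarrow> s > 0 \<Longrightarrow> t > 0 \<Longrightarrow> c (\<alpha> * s) (\<alpha> * t) = \<alpha> * c s t"
  shows "scaling_covariance c"
  unfolding scaling_covariance_def
proof (intro allI impI)
  fix \<alpha> s t :: real assume \<alpha>: "\<alpha> > 0" and s: "s \<ge> 0" and t: "t \<ge> 0"
  define e :: "nat \<Rightarrow> real" where "e n = inverse (real (Suc n))" for n
  have e: "e \<longlonglongrightarrow> 0" "e n > 0" for n
    unfolding e_def[abs_def] using LIMSEQ_inverse_real_of_nat by auto
  have se: "(\<lambda>n. r + e n) \<longlonglongrightarrow> r" for r using tendsto_add[OF tendsto_const e(1), of r] by simp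
  have se0: "r + e n > 0" if "r \<ge> 0" for r n using that e(2)[of n] by linarith
  have "(\<lambda>n. c (\<alpha> * (s + e n)) (\<alpha> * (t + e n))) \<longlonglongrightarrow> c (\<alpha> * s) (\<alpha> * t)"
    by (rule continuous_on_kernel_sequentially[OF cont])
       (use \<alpha> s t se0[OF s] se0[OF t] in \<open>auto intro: tendsto_mult se less_imp_le mult_nonneg_nonneg\<close>)
  moreover have "(\<lambda>n. \<alpha> * c (s + e n) (t + e n)) \<longlonglongrightarrow> \<alpha> * c s t"
    by (intro tendsto_mult tendsto_const continuous_on_kernel_sequentially[OF cont] se)
       (use s t se0[OF s] se0[OF t] in \<open>auto intro: less_imp_le\<close>)
  moreover have "c (\<alpha> * (s + e n)) (\<alpha> * (t + e n)) = \<alpha> * c (s + e n) (t + e n)" for n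
    by (rule pos[OF \<alpha> se0[OF s] se0[OF t]])
  ultimately show "c (\<alpha> * s) (\<alpha> * t) = \<alpha> * c s t" by (simp add: LIMSEQ_unique)
qed

lemma covariance_tilde_process:
  "covariance M (tilde_process G) y z = exp (- y / 2) * exp (- z / 2) * covariance M G (exp y) (exp z)"
proof -
  have "tilde_process G y \<omega> * tilde_process G z \<omega> =
      (exp (- y / 2) * exp (- z / 2)) * (G (exp y) \<omega> * G (exp z) \<omega>)" for \<omega>
    by (simp add: tilde_process_def mult_ac)
  then show ?thesis by (simp add: covariance_def)
qed

lemma covariance_eq_tilde_process:
  assumes "s > 0" "t > 0"
  shows "covariance M G s t = sqrt (s * t) * covariance M (tilde_process G) (ln s) (ln t)"
proof -
  have "exp (- ln r / 2) * sqrt r = 1" if "r > 0" for r :: real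
  proof -
    have "exp (ln r / 2) = sqrt r"
      using that by (intro real_sqrt_unique[symmetric]) (auto simp flip: exp_double)
    then show ?thesis using that by (simp add: exp_minus)
  qed
  note this[OF assms(1)] this[OF assms(2)]
  then have "sqrt (s * t) * (exp (- ln s / 2) * exp (- ln t / 2)) = 1"
    by (simp only: real_sqrt_mult) (metis mult.assoc mult.commute mult_1)
  then show ?thesis
    using assms unfolding covariance_tilde_process by (simp only: exp_ln mult.assoc[symmetric] mult_1)
qed

lemma scaling_covariance_iff_tilde_stationary:
  assumes cont: "continuous_on ({0..} \<times> {0..}) (\<lambda>(s, t). covariance M G s t)"
  shows "scaling_covariance (covariance M G) \<longleftrightarrow>
    (\<forall>h y z. covariance M (tilde_process G) (y + h) (z + h) = covariance M (tilde_process G) y z)"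
proof
  assume S: "scaling_covariance (covariance M G)"
  show "\<forall>h y z. covariance M (tilde_process G) (y + h) (z + h) = covariance M (tilde_process G) y z"
  proof (intro allI)
    fix h y z :: real
    \<comment> \<open>A shift by \<open>h\<close> is a dilation by exp h; the two weights together
      contribute exp (-h) and cancel the scaling factor.\<close>
    have "covariance M G (exp h * exp y) (exp h * exp z) = exp h * covariance M G (exp y) (exp z)"
      using S unfolding scaling_covariance_def by simp
    then have "covariance M G (exp (y + h)) (exp (z + h)) = exp h * covariance M G (exp y) (exp z)"
      by (simp only: exp_add mult.commute[of "exp h"])
    moreover have "exp (- (y + h) / 2) * exp (- (z + h) / 2) * exp h = exp (- y / 2) * exp (- z / 2)"
      by (simp add: field_simps flip: exp_add)
    ultimately show "covariance M (tilde_process G) (y + h) (z + h) = covariance M (tilde_process G) y z"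
      unfolding covariance_tilde_process by (simp only: mult.assoc[symmetric])
  qed
next
  assume st: "\<forall>h y z. covariance M (tilde_process G) (y + h) (z + h) = covariance M (tilde_process G) y z"
  show "scaling_covariance (covariance M G)"
  proof (rule scaling_covariance_of_pos[OF cont])
    fix \<alpha> s t :: real assume pos: "\<alpha> > 0" "s > 0" "t > 0"
    have "covariance M G (\<alpha> * s) (\<alpha> * t) =
        sqrt (\<alpha> * s * (\<alpha> * t)) * covariance M (tilde_process G) (ln (\<alpha> * s)) (ln (\<alpha> * t))"
      using pos by (intro covariance_eq_tilde_process) auto
    also have "covariance M (tilde_process G) (ln (\<alpha> * s)) (ln (\<alpha> * t)) = covariance M (tilde_process G) (ln s) (ln t)"
      using pos st[rule_format, of "ln s" "ln \<alpha>" "ln t"] by (simp add: ln_mult add.commute)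
    also have "sqrt (\<alpha> * s * (\<alpha> * t)) = \<alpha> * sqrt (s * t)"
      using pos by (simp add: real_sqrt_mult mult_ac flip: power2_eq_square)
    finally show "covariance M G (\<alpha> * s) (\<alpha> * t) = \<alpha> * covariance M G s t"
      using covariance_eq_tilde_process[OF pos(2,3), of M G] by simp
  qed
qed

section \<open>Spectral measures of stationary covariances\<close>

lemma spectral_measure_imp_stationary_covariance:
  assumes "spectral_measure_of M Y \<mu>"
  shows "covariance M Y (y + h) (z + h) = covariance M Y y z"
proof -
  have "complex_of_real (covariance M Y (y + h) (z + h)) = complex_of_real (covariance M Y y z)"
    using assms unfolding spectral_measure_of_def by simp
  then show ?thesis by (simp only: of_real_eq_iff)
qed

text \<open>Reflecting \<open>\<nu>\<close> reverses the argument of its characteristic function, so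
  evenness and uniqueness give reflection invariance. The constant density is multiplication by
  \<open>v\<close>.\<close>

lemma finite_symmetric_measure_scaled:
  assumes \<nu>: "real_distribution \<nu>" and sym: "\<And>t. char \<nu> (- t) = char \<nu> t" and v: "v \<ge> 0"
  shows "finite_symmetric_measure (density \<nu> (\<lambda>_. ennreal v))"
proof -
  interpret \<nu>: real_distribution \<nu> by fact
  have neg: "distr \<nu> borel uminus = \<nu>"
  proof (rule Levy_uniqueness)
    show "real_distribution (distr \<nu> borel uminus)"
      by (auto simp: real_distribution_def real_distribution_axioms_def intro!: \<nu>.prob_space_distr)
    have "char (distr \<nu> borel uminus) t = char \<nu> (- t)" for t
      unfolding char_def by (subst integral_distr) auto
    then show "char (distr \<nu> borel uminus) = char \<nu>" using sym by auto
  qed (rule \<nu>)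
  have "finite_measure (density \<nu> (\<lambda>_. ennreal v))"
    by (rule finite_measureI) (simp add: emeasure_density_const \<nu>.emeasure_eq_measure ennreal_mult_eq_top_iff)
  moreover have "distr (density \<nu> (\<lambda>_. ennreal v)) borel uminus = density \<nu> (\<lambda>_. ennreal v)"
  proof (rule measure_eqI)
    fix A :: "real set" assume "A \<in> sets (distr (density \<nu> (\<lambda>_. ennreal v)) borel uminus)"
    then have A[measurable]: "A \<in> sets borel" by simp
    have "emeasure \<nu> (uminus -` A) = emeasure \<nu> A"
      using emeasure_distr[of uminus \<nu> borel A] neg by simp
    moreover have "uminus -` A \<in> sets borel"
      using measurable_sets_borel[of uminus borel A] by simp
    ultimately show "emeasure (distr (density \<nu> (\<lambda>_. ennreal v)) borel uminus) A = emeasure (density \<nu> (\<lambda>_. ennreal v)) A"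
      by (simp add: emeasure_distr emeasure_density_const)
  qed simp
  ultimately show ?thesis by (simp add: finite_symmetric_measure_def)
qed

text \<open>Division by the common variance \<open>v\<close> makes the covariance a function with
  value 1 at 0. It is positive definite because its quadratic forms are second moments of
  combinations of \<open>Y\<close>.\<close>

theorem spectral_measure_exists:
  fixes Y :: "real \<Rightarrow> 'a \<Rightarrow> real"
  assumes meas: "\<And>y. Y y \<in> borel_measurable M" and sq: "\<And>y. integrable M (\<lambda>\<omega>. (Y y \<omega>)\<^sup>2)"
    and st: "\<And>h y z. covariance M Y (y + h) (z + h) = covariance M Y y z"
    and cont: "continuous_on UNIV (\<lambda>y. covariance M Y y 0)"
  shows "\<exists>\<mu>. spectral_measure_of M Y \<mu>"
proof -
  define v where "v = covariance M Y 0 0"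
  have vy: "(LINT \<omega>|M. (Y y \<omega>)\<^sup>2) = v" for y
    using st[of 0 y 0] by (simp add: v_def covariance_def power2_eq_square)
  have v0: "v \<ge> 0" unfolding vy[of 0, symmetric] by simp
  have stat: "covariance M Y y z = covariance M Y (y - z) 0" for y z
    using st[of "y - z" z 0] by simp
  have even: "covariance M Y (- y) 0 = covariance M Y y 0" for y
    using stat[of 0 y] covariance_sym[of M Y 0 y] by simp
  have int: "integrable M (\<lambda>\<omega>. Y y \<omega> * Y z \<omega>)" for y z
    by (rule integrable_mult_of_squares[OF meas meas sq sq])
  obtain \<nu> where \<nu>: "real_distribution \<nu>" "\<And>t. char \<nu> (- t) = char \<nu> t"
    "\<And>t. complex_of_real (covariance M Y t 0) = v * char \<nu> t"
  proof (cases "v = 0")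
    \<comment> \<open>Here the covariance vanishes by Cauchy-Schwarz, and the law is multiplied by 0
      in the end; the standard normal law serves because its characteristic function is
      even.\<close>
    case True
    have "\<bar>covariance M Y t 0\<bar> \<le> sqrt (LINT \<omega>|M. (Y t \<omega>)\<^sup>2) * sqrt (LINT \<omega>|M. (Y 0 \<omega>)\<^sup>2)" for t
      unfolding covariance_def by (rule integral_Cauchy_Schwarz[OF meas meas sq sq])
    then have "covariance M Y t 0 = 0" for t using True by (simp add: vy)
    then show thesis
      using True by (intro that[of std_normal_distribution]) (auto simp: real_dist_normal_dist char_std_normal_distribution)
  next
    case False
    define \<phi> where "\<phi> t = covariance M Y t 0 / v" for t
    have "isCont \<phi> t" for t
      using cont False unfolding \<phi>_def continuous_on_eq_continuous_at[OF open_UNIV]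
      by (auto intro!: continuous_intros)
    moreover have "0 \<le> (\<Sum>j<N. \<Sum>l<N. a j * a l * \<phi> (x j - x l))" for N and a x :: "nat \<Rightarrow> real"
    proof -
      have "0 \<le> (LINT \<omega>|M. (\<Sum>j\<in>{..<N}. a j * Y (x j) \<omega>)\<^sup>2)" by simp
      \<comment> \<open>The process is indexed by \<open>j\<close> instead of the point
        \<open>x j\<close>, since the points may coincide.\<close>
      also have "\<dots> = (\<Sum>j<N. \<Sum>l<N. a j * a l * covariance M (\<lambda>j. Y (x j)) j l)"
        by (rule integral_combination_square[where X="\<lambda>j. Y (x j)"]) (rule int)
      also have "\<dots> = v * (\<Sum>j<N. \<Sum>l<N. a j * a l * \<phi> (x j - x l))"
        using False stat by (simp add: \<phi>_def sum_distrib_left covariance_def)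
      finally show ?thesis using v0 False by (simp add: zero_le_mult_iff)
    qed
    moreover have "\<phi> 0 = 1" using False by (simp add: \<phi>_def v_def)
    moreover have "\<phi> (- t) = \<phi> t" for t by (simp add: \<phi>_def even)
    ultimately obtain \<nu> where "real_distribution \<nu>" "\<And>t. char \<nu> t = complex_of_real (\<phi> t)"
      using Bochner_real[of \<phi>] by metis
    then show thesis
      using False by (intro that[of \<nu>]) (auto simp: \<phi>_def even)
  qed
  interpret \<nu>: real_distribution \<nu> by fact
  let ?\<mu> = "density \<nu> (\<lambda>_. ennreal v)"
  have "complex_of_real (covariance M Y y z) = (CLINT u|?\<mu>. iexp (u * \<bar>y - z\<bar>))" for y z
  proof -
    have "covariance M Y y z = covariance M Y \<bar>y - z\<bar> 0"
      using stat[of y z] even[of "y - z"] by (simp add: abs_if)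
    then have "complex_of_real (covariance M Y y z) = v * char \<nu> \<bar>y - z\<bar>"
      using \<nu>(3) by simp
    also have "\<dots> = (CLINT u|?\<mu>. iexp (u * \<bar>y - z\<bar>))"
      unfolding char_def using v0
      by (subst integral_density) (auto simp: scaleR_conv_of_real mult.commute)
    finally show ?thesis .
  qed
  then show ?thesis
    using finite_symmetric_measure_scaled[OF \<nu>(1,2) v0] unfolding spectral_measure_of_def by blast
qed

section \<open>The properties of the process as identities for its covariance\<close>

lemma IDT_process_iff_nat_scaling:
  assumes M: "prob_space M" and G: "gaussian_process M {0..} G" "centered_process M {0..} G"
  shows "IDT_process M G \<longleftrightarrow>
    (\<forall>n\<ge>1. \<forall>s\<in>{0..}. \<forall>t\<in>{0..}. covariance M G (real n * s) (real n * t) = real n * covariance M G s t)"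
proof -
  have X: "gaussian_char M {0..} G (covariance M G)"
    by (rule prob_space.gaussian_char_covariance[OF M G])
  have "eq_in_law {0..} M (\<lambda>t. G (real n * t)) (copies_space n M) (\<lambda>t \<omega>. \<Sum>i<n. indep_copy G i t \<omega>) \<longleftrightarrow>
      (\<forall>s\<in>{0..}. \<forall>t\<in>{0..}. covariance M G (real n * s) (real n * t) = real n * covariance M G s t)"
    if n: "n \<ge> 1" for n
  proof -
    have "prob_space (copies_space n M)"
      unfolding copies_space_def by (intro prob_space_PiM M)
    moreover have "gaussian_char M {0..} (\<lambda>s \<omega>. 1 * G (real n * s) \<omega>)
        (\<lambda>s t. 1 * 1 * covariance M G (real n * s) (real n * t))"
      using n by (intro gaussian_char_reindex[OF X, where w="\<lambda>_. 1" and f="\<lambda>s. real n * s"]) (auto simp: inj_on_def)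
    ultimately show ?thesis
      using eq_in_law_iff_of_gaussian_char[OF M _ _ gaussian_char_sum_copies[OF M X, of n]] by simp
  qed
  then show ?thesis unfolding IDT_process_def by blast
qed

lemma self_similar_iff_scaling_covariance:
  assumes M: "prob_space M" and G: "gaussian_process M {0..} G" "centered_process M {0..} G"
  shows "(\<forall>\<alpha>>0. eq_in_law {0..} M (\<lambda>t. G (\<alpha> * t)) M (\<lambda>t \<omega>. sqrt \<alpha> * G t \<omega>)) \<longleftrightarrow>
    scaling_covariance (covariance M G)"
proof -
  have X: "gaussian_char M {0..} G (covariance M G)"
    by (rule prob_space.gaussian_char_covariance[OF M G])
  have "eq_in_law {0..} M (\<lambda>t. G (\<alpha> * t)) M (\<lambda>t \<omega>. sqrt \<alpha> * G t \<omega>) \<longleftrightarrow>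
      (\<forall>s\<in>{0..}. \<forall>t\<in>{0..}. covariance M G (\<alpha> * s) (\<alpha> * t) = \<alpha> * covariance M G s t)"
    if \<alpha>: "\<alpha> > 0" for \<alpha>
  proof -
    have "gaussian_char M {0..} (\<lambda>s \<omega>. 1 * G (\<alpha> * s) \<omega>) (\<lambda>s t. 1 * 1 * covariance M G (\<alpha> * s) (\<alpha> * t))"
      using \<alpha> by (intro gaussian_char_reindex[OF X, where w="\<lambda>_. 1" and f="\<lambda>s. \<alpha> * s"]) (auto simp: inj_on_def)
    moreover have "gaussian_char M {0..} (\<lambda>s \<omega>. sqrt \<alpha> * G s \<omega>) (\<lambda>s t. sqrt \<alpha> * sqrt \<alpha> * covariance M G s t)"
      using gaussian_char_reindex[OF X, where w="\<lambda>_. sqrt \<alpha>" and f="\<lambda>s. s" and S="{0..}"] by simp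
    ultimately show ?thesis
      using eq_in_law_iff_of_gaussian_char[OF M M] \<alpha> by simp
  qed
  then show ?thesis unfolding scaling_covariance_def by auto
qed

lemma strictly_stationary_tilde_iff:
  assumes M: "prob_space M" and G: "gaussian_process M {0..} G" "centered_process M {0..} G"
  shows "strictly_stationary M (tilde_process G) \<longleftrightarrow>
    (\<forall>h y z. covariance M (tilde_process G) (y + h) (z + h) = covariance M (tilde_process G) y z)"
proof -
  have X: "gaussian_char M {0..} G (covariance M G)"
    by (rule prob_space.gaussian_char_covariance[OF M G])
  \<comment> \<open>Stated for every \<open>h\<close>, so that \<open>h = 0\<close> also describes
    the unshifted process.\<close>
  have shift: "gaussian_char M UNIV (\<lambda>y. tilde_process G (y + h))
      (\<lambda>y z. covariance M (tilde_process G) (y + h) (z + h))" for h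
  proof -
    have "(\<lambda>y. tilde_process G (y + h)) = (\<lambda>y \<omega>. exp (- (y + h) / 2) * G (exp (y + h)) \<omega>)"
      by (intro ext) (simp add: tilde_process_def)
    moreover have "gaussian_char M UNIV (\<lambda>y \<omega>. exp (- (y + h) / 2) * G (exp (y + h)) \<omega>)
        (\<lambda>y z. exp (- (y + h) / 2) * exp (- (z + h) / 2) * covariance M G (exp (y + h)) (exp (z + h)))"
      by (rule gaussian_char_reindex[OF X]) (auto simp: inj_on_def)
    ultimately show ?thesis by (simp only: covariance_tilde_process)
  qed
  have "eq_in_law UNIV M (\<lambda>y. tilde_process G (y + h)) M (tilde_process G) \<longleftrightarrow>
      (\<forall>y z. covariance M (tilde_process G) (y + h) (z + h) = covariance M (tilde_process G) y z)" for h
    using eq_in_law_iff_of_gaussian_char[OF M M shift[of h] shift[of 0]] by simp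
  then show ?thesis unfolding strictly_stationary_def by simp
qed

lemma spectral_measure_tilde_exists:
  assumes M: "prob_space M" and G: "gaussian_process M {0..} G" "centered_process M {0..} G"
    and cont: "continuous_on ({0..} \<times> {0..}) (\<lambda>(s, t). covariance M G s t)"
    and st: "\<And>h y z. covariance M (tilde_process G) (y + h) (z + h) = covariance M (tilde_process G) y z"
  shows "\<exists>\<mu>. spectral_measure_of M (tilde_process G) \<mu>"
proof (rule spectral_measure_exists)
  interpret prob_space M by fact
  fix y :: real
  have "G (exp y) \<in> borel_measurable M"
    using G(1) unfolding gaussian_process_def by simp
  then show "tilde_process G y \<in> borel_measurable M"
    unfolding tilde_process_def[abs_def] by simp
  have "integrable M (\<lambda>\<omega>. (G (exp y) \<omega>)\<^sup>2)"
    by (rule gaussian_process_square_integrable[OF G]) simp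
  then show "integrable M (\<lambda>\<omega>. (tilde_process G y \<omega>)\<^sup>2)"
    unfolding tilde_process_def by (simp add: power_mult_distrib)
next
  have "continuous_on UNIV (\<lambda>y. case (exp y, 1) of (s, t) \<Rightarrow> covariance M G s t)"
    by (rule continuous_on_compose2[OF cont, of UNIV "\<lambda>y. (exp y, 1)"]) (auto intro!: continuous_intros)
  then show "continuous_on UNIV (\<lambda>y. covariance M (tilde_process G) y 0)"
    unfolding covariance_tilde_process by (auto intro!: continuous_intros)
qed (rule st)

theorem proposition3p2:
  fixes M :: "'a measure" and G :: "real \<Rightarrow> 'a \<Rightarrow> real"
  assumes "prob_space M"
    and "gaussian_process M {0..} G"
    and "centered_process M {0..} G"
  shows "(continuous_in_probability M {0..} G \<longleftrightarrow>
            continuous_on ({0..} \<times> {0..}) (\<lambda>(s, t). covariance M G s t)) \<and>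
         (continuous_in_probability M {0..} G \<longrightarrow>
            (IDT_process M G \<longleftrightarrow>
               (\<forall>\<alpha>>0. \<forall>s t. 0 \<le> s \<and> s \<le> t \<longrightarrow>
                  covariance M G (\<alpha> * s) (\<alpha> * t) = \<alpha> * covariance M G s t)) \<and>
            (IDT_process M G \<longleftrightarrow>
               (\<forall>\<alpha>>0. eq_in_law {0..} M (\<lambda>t. G (\<alpha> * t)) M (\<lambda>t \<omega>. sqrt \<alpha> * G t \<omega>))) \<and>
            (IDT_process M G \<longleftrightarrow> strictly_stationary M (tilde_process G)) \<and>
            (IDT_process M G \<longleftrightarrow> (\<exists>\<mu>. spectral_measure_of M (tilde_process G) \<mu>)) \<and>
            (IDT_process M G \<longrightarrow>
               (\<forall>\<mu>. spectral_measure_of M (tilde_process G) \<mu> \<longrightarrow>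
                  (\<forall>s t. s > 0 \<and> t > 0 \<longrightarrow>
                     complex_of_real (covariance M G s t) =
                       complex_of_real (sqrt (s * t)) * (CLINT a|\<mu>. iexp (a * \<bar>ln (s / t)\<bar>))))))"
proof -
  let ?c = "covariance M G"
  note M = assms(1) and G = assms(2,3)
  have cont_iff: "continuous_in_probability M {0..} G \<longleftrightarrow> continuous_on ({0..} \<times> {0..}) (\<lambda>(s, t). ?c s t)"
    by (rule prob_space.continuous_in_probability_iff_covariance_continuous[OF M G])
  have two: "(\<forall>\<alpha>>0. \<forall>s t. 0 \<le> s \<and> s \<le> t \<longrightarrow> ?c (\<alpha> * s) (\<alpha> * t) = \<alpha> * ?c s t) \<longleftrightarrow> scaling_covariance ?c"
    (is "?L \<longleftrightarrow> _")
  proof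
    assume L: ?L
    show "scaling_covariance ?c"
      unfolding scaling_covariance_def
    proof (intro allI impI)
      fix \<alpha> s t :: real assume "\<alpha> > 0" "s \<ge> 0" "t \<ge> 0"
      then show "?c (\<alpha> * s) (\<alpha> * t) = \<alpha> * ?c s t"
        using L[rule_format, of \<alpha> s t] L[rule_format, of \<alpha> t s]
          covariance_sym[of M G s t] covariance_sym[of M G "\<alpha> * s" "\<alpha> * t"]
        by (cases "s \<le> t") auto
    qed
  next
    assume "scaling_covariance ?c"
    then show ?L unfolding scaling_covariance_def by auto
  qed
  \<comment> \<open>\<open>scaling_covariance\<close> is the hub: each property is translated into a
    covariance identity and compared with it. Continuity in probability enters as continuity of the
    covariance.\<close>
  have equiv: "(IDT_process M G \<longleftrightarrow> scaling_covariance ?c) \<and>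
      (IDT_process M G \<longleftrightarrow> strictly_stationary M (tilde_process G)) \<and>
      (IDT_process M G \<longleftrightarrow> (\<exists>\<mu>. spectral_measure_of M (tilde_process G) \<mu>))"
    if "continuous_in_probability M {0..} G"
  proof -
    have cont: "continuous_on ({0..} \<times> {0..}) (\<lambda>(s, t). ?c s t)" using that cont_iff by simp
    have "IDT_process M G \<longleftrightarrow> scaling_covariance ?c"
    proof
      assume "IDT_process M G"
      then show "scaling_covariance ?c"
        unfolding IDT_process_iff_nat_scaling[OF M G]
        by (intro scaling_covariance_of_nat_scaling[OF cont]) auto
    next
      assume "scaling_covariance ?c"
      then show "IDT_process M G"
        unfolding IDT_process_iff_nat_scaling[OF M G] scaling_covariance_def by auto
    qed
    moreover have "scaling_covariance ?c \<longleftrightarrow> strictly_stationary M (tilde_process G)"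
      unfolding strictly_stationary_tilde_iff[OF M G] by (rule scaling_covariance_iff_tilde_stationary[OF cont])
    moreover have "strictly_stationary M (tilde_process G) \<longleftrightarrow> (\<exists>\<mu>. spectral_measure_of M (tilde_process G) \<mu>)"
      unfolding strictly_stationary_tilde_iff[OF M G]
      using spectral_measure_tilde_exists[OF M G cont]
        spectral_measure_imp_stationary_covariance[of M "tilde_process G"] by metis
    ultimately show ?thesis by simp
  qed
  \<comment> \<open>The spectral formula at y = ln s and z = ln t; undoing the weights of the
    transformed process produces sqrt (s t).\<close>
  have formula: "complex_of_real (?c s t) = complex_of_real (sqrt (s * t)) * (CLINT a|\<mu>. iexp (a * \<bar>ln (s / t)\<bar>))"
    if \<mu>: "spectral_measure_of M (tilde_process G) \<mu>" and st: "s > 0" "t > 0" for \<mu> s t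
  proof -
    have "complex_of_real (covariance M (tilde_process G) (ln s) (ln t)) = (CLINT a|\<mu>. iexp (a * \<bar>ln s - ln t\<bar>))"
      using \<mu> unfolding spectral_measure_of_def by blast
    moreover have "ln (s / t) = ln s - ln t" using st by (simp add: ln_div)
    ultimately show ?thesis
      unfolding covariance_eq_tilde_process[OF st] of_real_mult[of "sqrt (s * t)"] by (simp only:)
  qed
  show ?thesis
    unfolding two self_similar_iff_scaling_covariance[OF M G]
    using cont_iff equiv formula by blast
qed

end
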